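(* Let $X_1,X_2,U_1,U_2$ be Hilbert spaces, let $(G_1,L_1,K_1)$ be an impedance passive boundary node on $(U_1,X_1,U_1)$, let $A_2\colon D(A_2)\subseteq X_2\to X_2$ be a linear operator such that $\lambda-A_2$ is surjective for some $\lambda\in\mathbb{C}$ with $\operatorname{Re}\lambda>0$, and let $B_2\in\mathcal{B}(U_2,X_2)$, $C_2\in\mathcal{B}(X_2,U_2)$ and $D_2\in\mathcal{B}(U_2)$ be such that $$\operatorname{Re}\langle A_2x+B_2u,x\rangle_{X_2}\le\operatorname{Re}\langle C_2x+D_2u,u\rangle_{U_2},\qquad x\in D(A_2),\ u\in U_2.$$ Let $J\in\mathcal{B}(U_1,U_2)$, let $Q\in\mathcal{B}(U_2)$ be a self-adjoint operator such that $Q\ge0$, let $A_0$ denote the restriction of $L_1$ to $\operatorname{Ker}(G_1+J^*QJK_1)$ and let $H_0\colon\rho(A_0)\to\mathcal{B}(U_1,X_1)$ be the ($H$-type) transfer function of the boundary node $(G_1+J^*QJK_1,L_1,K_1)$. Suppose there exists a non-empty set $E\subseteq\{s\in\mathbb{R}:is\in\rho(A_0)\cap\rho(A_2)\}$. Furthermore, let $N_0,M_0,M_2\colon E\to[r,\infty)$, for some $r>0$, be such that $\|H_0(is)\|\le N_0(s)$ for $s\in E$ and $$\|(is-A_j)^{-1}\|\le M_j(s),\qquad s\in E,$$ for $j=0,2$, and suppose there exists a function $\eta\colon E\to(0,\infty)$ such that $$\operatorname{Re}\big(C_2(is-A_2)^{-1}B_2+D_2\big)\ge\eta(s)I,\qquad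 s\in E.$$ Let $X=X_1\times X_2$ and let $A\colon D(A)\subseteq X\to X$ be given by $$A=\begin{pmatrix}L_1&0\\-B_2JK_1&A_2\end{pmatrix},\qquad D(A)=\{(x_1,x_2)^\top\in D(L_1)\times D(A_2):(G_1+J^*D_2JK_1)x_1=J^*C_2x_2\}.$$ Then $A$ generates a contraction semigroup on $X$, $iE\subseteq\rho(A)$, and there is a constant $C>0$ independent of $s$ such that $$\|(is-A)^{-1}\|\le C\left(M_0(s)+\frac{N_0(s)^2M_2(s)^2}{\eta(s)}\right),\qquad s\in E.$$
   Context: All spaces are complex; $\mathcal{B}(X,Y)$ denotes the bounded linear operators from $X$ to $Y$, $\mathcal{B}(X)=\mathcal{B}(X,X)$, and $\rho(\cdot)$ is the resolvent set. Domains of linear operators carry the graph norm. For a bounded operator $T$ on a Hilbert space, $\operatorname{Re}T=\frac12(T+T^* )$, and for self-adjoint bounded $S,T$ we write $T\ge S$ if $\langle Tx-Sx,x\rangle\ge0$ for all $x$. Let $X,U$ be Hilbert spaces and let $L\colon D(L)\subseteq X\to X$ and $G,K\colon D(L)\subseteq X\to U$ be linear. The triple $(G,L,K)$ is a boundary node on $(U,X,U)$ if (i) $G,K\in\mathcal{B}(D(L),U)$; (ii) the restriction $A$ of $L$ to $\operatorname{Ker}G$ generates a $C_0$-semigroup on $X$; (iii) there exists $G^r\in\mathcal{B}(U,D(L))$ with $GG^r=I$. It is impedance passive if $\operatorname{Re}\langle Lx,x\rangle_X\le\operatorname{Re}\langle Gx,Kx\rangle_U$ for all $x\in D(L)$.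 With $A$ the restriction of $L$ to $\operatorname{Ker}G$, the transfer function $H\colon\rho(A)\to\mathcal{B}(U,X)$ of a boundary node $(G,L,K)$ is defined by $H(\lambda)u=x$, where $x\in D(L)$ is the unique solution of $(\lambda-L)x=0$, $Gx=u$. For $Q=Q^*\ge0$ the triple $(G_1+J^*QJK_1,L_1,K_1)$ is an impedance passive boundary node on $(U_1,X_1,U_1)$.
   Formalization: The Hilbert space U_2 is assumed to be nonzero; for U_2={0} the lower bound by η(s)I is vacuous, so η can be arbitrarily large and the claimed resolvent estimate fails. *)

theory Defs
  imports "HOL-Analysis.Analysis"
begin

section \<open>Complex Hilbert spaces\<close>

text \<open>
  Complex scalars and the complex inner product are added on top of the library's
  real structure. Every complex inner product space is a real one with
  inner product \<open>Re \<langle>x, y\<rangle>\<close>, and this induces the same norm, so nothing is lost.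
  Thus \<open>norm\<close>, \<open>onorm\<close>, limits and the Hilbert space structure on products are those
  of the library. The inner product is linear in its first argument.
\<close>

class scaleC =
  fixes scaleC :: "complex \<Rightarrow> 'a \<Rightarrow> 'a" (infixr \<open>*\<^sub>C\<close> 75)

class complex_vector = scaleC + real_vector +
  assumes scaleC_add_right: "a *\<^sub>C (x + y) = a *\<^sub>C x + a *\<^sub>C y"
    and scaleC_add_left: "(a + b) *\<^sub>C x = a *\<^sub>C x + b *\<^sub>C x"
    and scaleC_scaleC: "a *\<^sub>C b *\<^sub>C x = (a * b) *\<^sub>C x"
    and scaleC_complex_of_real: "complex_of_real r *\<^sub>C x = r *\<^sub>R x"

class complex_inner = complex_vector + real_inner +
  fixes cinner :: "'a \<Rightarrow> 'a \<Rightarrow> complex"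
  assumes cinner_commute: "cinner x y = cnj (cinner y x)"
    and cinner_add_left: "cinner (x + y) z = cinner x z + cinner y z"
    and cinner_scaleC_left: "cinner (a *\<^sub>C x) y = a * cinner x y"
    and inner_eq_Re_cinner: "inner x y = Re (cinner x y)"

class chilbert_space = complex_inner + complete_space

subclass (in chilbert_space) banach ..

instantiation complex :: chilbert_space
begin

definition scaleC_complex :: "complex \<Rightarrow> complex \<Rightarrow> complex"
  where "scaleC_complex a x = a * x"

definition cinner_complex :: "complex \<Rightarrow> complex \<Rightarrow> complex"
  where "cinner_complex x y = x * cnj y"

instance
  by standard
    (simp_all add: scaleC_complex_def cinner_complex_def algebra_simps scaleR_conv_of_real
      inner_complex_def)

end

instantiation prod :: (complex_vector, complex_vector) complex_vector
begin

definition scaleC_prod :: "complex \<Rightarrow> 'a \<times> 'b \<Rightarrow> 'a \<times> 'b"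
  where "scaleC_prod a x = (a *\<^sub>C fst x, a *\<^sub>C snd x)"

instance
  by standard
    (simp_all add: scaleC_prod_def prod_eq_iff scaleC_add_right scaleC_add_left scaleC_scaleC
      scaleC_complex_of_real)

end

instantiation prod :: (complex_inner, complex_inner) complex_inner
begin

definition cinner_prod :: "'a \<times> 'b \<Rightarrow> 'a \<times> 'b \<Rightarrow> complex"
  where "cinner_prod x y = cinner (fst x) (fst y) + cinner (snd x) (snd y)"

instance
proof
  fix x y z :: "'a \<times> 'b" and a :: complex
  show "cinner x y = cnj (cinner y x)"
    unfolding cinner_prod_def
    by (metis cinner_commute complex_cnj_add)
  show "cinner (x + y) z = cinner x z + cinner y z"
    by (simp add: cinner_prod_def cinner_add_left)
  show "cinner (a *\<^sub>C x) y = a * cinner x y"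
    by (simp add: cinner_prod_def scaleC_prod_def cinner_scaleC_left algebra_simps)
  show "inner x y = Re (cinner x y)"
    by (simp add: cinner_prod_def inner_prod_def inner_eq_Re_cinner)
qed

end

instance prod :: (chilbert_space, chilbert_space) chilbert_space ..


section \<open>Operators\<close>

definition bounded_clinear :: "('a::complex_inner \<Rightarrow> 'b::complex_inner) \<Rightarrow> bool"
  where "bounded_clinear T \<longleftrightarrow> bounded_linear T \<and> (\<forall>c x. T (c *\<^sub>C x) = c *\<^sub>C T x)"

definition cadjoint :: "('a::chilbert_space \<Rightarrow> 'b::chilbert_space) \<Rightarrow> 'b \<Rightarrow> 'a"
  where "cadjoint T = (THE S. \<forall>x y. cinner (T x) y = cinner x (S y))"

definition selfadjoint :: "('a::chilbert_space \<Rightarrow> 'a) \<Rightarrow> bool"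
  where "selfadjoint T \<longleftrightarrow> bounded_clinear T \<and> cadjoint T = T"

definition op_Re :: "('a::chilbert_space \<Rightarrow> 'a) \<Rightarrow> 'a \<Rightarrow> 'a"
  where "op_Re T x = (1/2) *\<^sub>R (T x + cadjoint T x)"

text \<open>
  The order \<open>T \<ge> S\<close>, meant for self-adjoint bounded operators; \<open>\<langle>Tx - Sx, x\<rangle> \<ge> 0\<close> says
  that this complex number is real and nonnegative.
\<close>

definition op_ge :: "('a::chilbert_space \<Rightarrow> 'a) \<Rightarrow> ('a \<Rightarrow> 'a) \<Rightarrow> bool"
  where "op_ge T S \<longleftrightarrow> (\<forall>x. cinner (T x - S x) x \<in> \<real> \<and> 0 \<le> Re (cinner (T x - S x) x))"

text \<open>
  An operator with domain \<open>D(T) \<subseteq> X\<close> is given by the set \<open>D\<close> and a total function \<open>T\<close> whose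
  values outside \<open>D\<close> are irrelevant.
\<close>

definition clinear_on :: "'a::complex_vector set \<Rightarrow> ('a \<Rightarrow> 'b::complex_vector) \<Rightarrow> bool"
  where "clinear_on D T \<longleftrightarrow>
    0 \<in> D \<and> (\<forall>x\<in>D. \<forall>y\<in>D. x + y \<in> D \<and> T (x + y) = T x + T y) \<and>
    (\<forall>c. \<forall>x\<in>D. c *\<^sub>C x \<in> D \<and> T (c *\<^sub>C x) = c *\<^sub>C T x)"

definition graph_norm :: "('a::real_normed_vector \<Rightarrow> 'b::real_normed_vector) \<Rightarrow> 'a \<Rightarrow> real"
  where "graph_norm T x = sqrt ((norm x)\<^sup>2 + (norm (T x))\<^sup>2)"

definition ker_on :: "'a set \<Rightarrow> ('a \<Rightarrow> 'b::zero) \<Rightarrow> 'a set"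
  where "ker_on D G = {x \<in> D. G x = 0}"

definition resolvent :: "'a::complex_inner set \<Rightarrow> ('a \<Rightarrow> 'a) \<Rightarrow> complex \<Rightarrow> 'a \<Rightarrow> 'a"
  where "resolvent D A \<mu> y = (THE x. x \<in> D \<and> \<mu> *\<^sub>C x - A x = y)"

definition resolvent_set :: "'a::complex_inner set \<Rightarrow> ('a \<Rightarrow> 'a) \<Rightarrow> complex set"
  where "resolvent_set D A =
    {\<mu>. bij_betw (\<lambda>x. \<mu> *\<^sub>C x - A x) D UNIV \<and> bounded_clinear (resolvent D A \<mu>)}"


section \<open>Strongly continuous semigroups\<close>

definition C0_semigroup :: "(real \<Rightarrow> 'a::complex_inner \<Rightarrow> 'a) \<Rightarrow> bool"
  where "C0_semigroup S \<longleftrightarrow>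
    (\<forall>t\<ge>0. bounded_clinear (S t)) \<and> S 0 = id \<and>
    (\<forall>s\<ge>0. \<forall>t\<ge>0. S (s + t) = S s \<circ> S t) \<and>
    (\<forall>x. ((\<lambda>t. S t x) \<longlongrightarrow> x) (at_right 0))"

text \<open>The domain \<open>D\<close> of the generator is exactly the set where the limit exists.\<close>

definition is_generator :: "(real \<Rightarrow> 'a::complex_inner \<Rightarrow> 'a) \<Rightarrow> 'a set \<Rightarrow> ('a \<Rightarrow> 'a) \<Rightarrow> bool"
  where "is_generator S D A \<longleftrightarrow>
    (\<forall>x y. x \<in> D \<and> A x = y \<longleftrightarrow> ((\<lambda>t. (1/t) *\<^sub>R (S t x - x)) \<longlongrightarrow> y) (at_right 0))"

definition generates_C0_semigroup :: "'a::complex_inner set \<Rightarrow> ('a \<Rightarrow> 'a) \<Rightarrow> bool"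
  where "generates_C0_semigroup D A \<longleftrightarrow> (\<exists>S. C0_semigroup S \<and> is_generator S D A)"

definition generates_contraction_semigroup :: "'a::complex_inner set \<Rightarrow> ('a \<Rightarrow> 'a) \<Rightarrow> bool"
  where "generates_contraction_semigroup D A \<longleftrightarrow>
    (\<exists>S. C0_semigroup S \<and> is_generator S D A \<and> (\<forall>t\<ge>0. onorm (S t) \<le> 1))"


section \<open>Boundary nodes\<close>

text \<open>
  All of \<open>L\<close>, \<open>G\<close>, \<open>K\<close> have the domain \<open>D = D(L)\<close>, which carries the graph norm of \<open>L\<close>.
\<close>

definition boundary_node ::
  "'x::chilbert_space set \<Rightarrow> ('x \<Rightarrow> 'u::chilbert_space) \<Rightarrow> ('x \<Rightarrow> 'x) \<Rightarrow> ('x \<Rightarrow> 'u) \<Rightarrow> bool"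
  where "boundary_node D G L K \<longleftrightarrow>
    clinear_on D L \<and> clinear_on D G \<and> clinear_on D K \<and>
    (\<exists>c. \<forall>x\<in>D. norm (G x) \<le> c * graph_norm L x) \<and>
    (\<exists>c. \<forall>x\<in>D. norm (K x) \<le> c * graph_norm L x) \<and>
    generates_C0_semigroup (ker_on D G) L \<and>
    (\<exists>Gr. clinear_on UNIV Gr \<and> (\<forall>u. Gr u \<in> D \<and> G (Gr u) = u) \<and>
      (\<exists>c. \<forall>u. graph_norm L (Gr u) \<le> c * norm u))"

definition impedance_passive ::
  "'x::chilbert_space set \<Rightarrow> ('x \<Rightarrow> 'u::chilbert_space) \<Rightarrow> ('x \<Rightarrow> 'x) \<Rightarrow> ('x \<Rightarrow> 'u) \<Rightarrow> bool"
  where "impedance_passive D G L K \<longleftrightarrow>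
    (\<forall>x\<in>D. Re (cinner (L x) x) \<le> Re (cinner (G x) (K x)))"

text \<open>
  Meaningful for \<open>\<mu>\<close> in the resolvent set of the restriction of \<open>L\<close> to \<open>Ker G\<close>; \<open>K\<close> plays no role.
\<close>

definition transfer_H ::
  "'x::chilbert_space set \<Rightarrow> ('x \<Rightarrow> 'u::chilbert_space) \<Rightarrow> ('x \<Rightarrow> 'x) \<Rightarrow> complex \<Rightarrow> 'u \<Rightarrow> 'x"
  where "transfer_H D G L \<mu> u = (THE x. x \<in> D \<and> \<mu> *\<^sub>C x - L x = 0 \<and> G x = u)"

text \<open>The operator \<open>G + J\<^sup>*PJK\<close>.\<close>

definition feedback_input ::
  "('x \<Rightarrow> 'u::chilbert_space) \<Rightarrow> ('x \<Rightarrow> 'u) \<Rightarrow> ('u \<Rightarrow> 'v::chilbert_space) \<Rightarrow> ('v \<Rightarrow> 'v) \<Rightarrow> 'x \<Rightarrow> 'u"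
  where "feedback_input G K J P x = G x + cadjoint J (P (J (K x)))"

definition coupled_dom ::
  "'x1 set \<Rightarrow> ('x1 \<Rightarrow> 'u1::chilbert_space) \<Rightarrow> ('x1 \<Rightarrow> 'u1) \<Rightarrow> ('u1 \<Rightarrow> 'u2::chilbert_space) \<Rightarrow>
    'x2 set \<Rightarrow> ('x2 \<Rightarrow> 'u2) \<Rightarrow> ('u2 \<Rightarrow> 'u2) \<Rightarrow> ('x1 \<times> 'x2) set"
  where "coupled_dom DL1 G1 K1 J DA2 C2 D2 =
    {(x1, x2). x1 \<in> DL1 \<and> x2 \<in> DA2 \<and> feedback_input G1 K1 J D2 x1 = cadjoint J (C2 x2)}"

definition coupled_op ::
  "('x1 \<Rightarrow> 'x1) \<Rightarrow> ('x1 \<Rightarrow> 'u1) \<Rightarrow> ('u1 \<Rightarrow> 'u2) \<Rightarrow> ('x2 \<Rightarrow> 'x2::ab_group_add) \<Rightarrow> ('u2 \<Rightarrow> 'x2) \<Rightarrow>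
    'x1 \<times> 'x2 \<Rightarrow> 'x1 \<times> 'x2"
  where "coupled_op L1 K1 J A2 B2 = (\<lambda>(x1, x2). (L1 x1, - B2 (J (K1 x1)) + A2 x2))"

end

theory Submission
  imports Defs
begin

text \<open>
  Everything rests on the energy balance. Let \<open>(is - A)(x\<^sub>1, x\<^sub>2) = (y\<^sub>1, y\<^sub>2)\<close>, let
  \<open>z = J K\<^sub>1 x\<^sub>1\<close> be the signal exchanged by the two systems, and let \<open>P\<close> be the transfer function of
  the second system at \<open>is\<close>. Impedance passivity of the first system and \<open>Re P \<ge> \<eta>\<close> give
  \<open>\<eta> \<parallel>z\<parallel>\<^sup>2 \<le> Re \<langle>P z, z\<rangle> \<le> \<parallel>y\<^sub>1\<parallel> \<parallel>x\<^sub>1\<parallel> + \<parallel>C\<^sub>2 R\<^sub>2 y\<^sub>2\<parallel> \<parallel>z\<parallel>\<close>, while \<open>x\<^sub>1\<close> and \<open>x\<^sub>2\<close> are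
  expressed linearly in \<open>y\<^sub>1, y\<^sub>2, z\<close> through \<open>(is - A\<^sub>0)\<^sup>-\<^sup>1\<close>, \<open>H\<^sub>0\<close> and \<open>R\<^sub>2 = (is - A\<^sub>2)\<^sup>-\<^sup>1\<close>.
  Absorbing \<open>\<parallel>x\<^sub>1\<parallel>\<close> by a quadratic inequality yields the resolvent bound.

  Surjectivity of \<open>is - A\<close> reduces to solving \<open>z + T(P - Q)z = f\<close> with \<open>T = J K\<^sub>1 H\<^sub>0 J\<^sup>*\<close>, which the
  method of continuity does, the a priori bound coming from \<open>Re \<langle>v, T v\<rangle> \<ge> \<langle>Q T v, T v\<rangle>\<close>. Since
  \<open>E\<close> is non-empty and \<open>A\<close> is dissipative, one point of \<open>iE\<close> in \<open>\<rho>(A)\<close> makes \<open>A\<close> m-dissipative, so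
  that the Lumer-Phillips theorem applies. Its semigroup is the limit of the implicit Euler
  scheme \<open>(1 - tA/n)\<^sup>-\<^sup>n\<close> along \<open>n = 2\<^sup>k\<close>, where the resolvent identity gives the errors directly
  on \<open>D(A\<^sup>2)\<close>.
\<close>

section \<open>Complex Hilbert spaces\<close>

lemma scaleC_zero_left [simp]: "0 *\<^sub>C (x :: 'a::complex_vector) = 0"
  using scaleC_complex_of_real[of 0 x] by simp

lemma scaleC_zero_right [simp]: "a *\<^sub>C (0 :: 'a::complex_vector) = 0"
  using scaleC_add_right[of a "0::'a" 0] by simp

lemma scaleC_minus_right: "a *\<^sub>C (- x) = - (a *\<^sub>C (x :: 'a::complex_vector))"
  using scaleC_add_right[of a x "- x"] by (simp add: eq_neg_iff_add_eq_0 add.commute)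

lemma scaleC_diff_right: "a *\<^sub>C (x - y) = a *\<^sub>C x - a *\<^sub>C (y :: 'a::complex_vector)"
  using scaleC_add_right[of a x "- y"] by (simp add: scaleC_minus_right)

lemma scaleC_diff_left: "(a - b) *\<^sub>C x = a *\<^sub>C x - b *\<^sub>C (x :: 'a::complex_vector)"
  using scaleC_add_left[of "a - b" b x] by (simp add: eq_diff_eq)

lemma scaleC_scaleR: "a *\<^sub>C (r *\<^sub>R x) = r *\<^sub>R (a *\<^sub>C (x :: 'a::complex_vector))"
  by (simp add: scaleC_scaleC mult.commute flip: scaleC_complex_of_real)

lemma Im_cinner_self: "Im (cinner x x) = 0"
  using arg_cong[OF cinner_commute[of x x], of Im] by simp

lemma cinner_self: "cinner x x = complex_of_real (inner x x)"
  by (simp add: complex_eq_iff Im_cinner_self inner_eq_Re_cinner)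

lemma Re_cinner: "Re (cinner x y) = inner x y"
  by (simp add: inner_eq_Re_cinner)

lemma Im_cinner: "Im (cinner x y) = - inner (\<i> *\<^sub>C x) y"
  by (simp add: inner_eq_Re_cinner cinner_scaleC_left)

lemma cinner_scaleC_right: "cinner x (a *\<^sub>C y) = cnj a * cinner x y"
  by (metis cinner_commute cinner_scaleC_left complex_cnj_mult)

lemma inner_scaleC_self: "inner (a *\<^sub>C x) x = Re a * (norm (x :: 'a::complex_inner))\<^sup>2"
  by (simp add: inner_eq_Re_cinner[of "a *\<^sub>C x" x] cinner_scaleC_left cinner_self
      power2_norm_eq_inner)

lemma norm_scaleC [simp]: "norm (a *\<^sub>C x) = cmod a * norm (x :: 'a::complex_inner)"
proof -
  have "inner (a *\<^sub>C x) (a *\<^sub>C x) = (cmod a)\<^sup>2 * inner x x"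
    unfolding cmod_power2
    by (simp add: inner_eq_Re_cinner cinner_scaleC_left cinner_scaleC_right Im_cinner_self
        power2_eq_square algebra_simps)
  then show ?thesis
    by (simp add: norm_eq_sqrt_inner real_sqrt_mult)
qed

text \<open>The imaginary parts are, up to sign, the real parts taken at
  \<open>\<i> *\<^sub>C x\<close>. This upgrades adjoint identities from the real to the complex
  inner product.\<close>

lemma cinner_eqI:
  assumes "\<And>x. inner (T x) y = inner x z" "\<And>x. T (\<i> *\<^sub>C x) = \<i> *\<^sub>C T x"
  shows "cinner (T x) y = cinner x z"
  using assms(1)[of x] assms(1)[of "\<i> *\<^sub>C x"]
  by (simp add: complex_eq_iff Re_cinner Im_cinner assms(2))

section \<open>Bounded complex-linear maps\<close>

lemma bounded_clinear_scaleC: "bounded_clinear T \<Longrightarrow> T (c *\<^sub>C x) = c *\<^sub>C T x"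
  by (simp add: bounded_clinear_def)

lemma bounded_clinear_imp_linear: "bounded_clinear T \<Longrightarrow> bounded_linear T"
  by (simp add: bounded_clinear_def)

lemma bounded_clinear_compose:
  "bounded_clinear S \<Longrightarrow> bounded_clinear T \<Longrightarrow> bounded_clinear (\<lambda>x. S (T x))"
  by (auto simp: bounded_clinear_def intro: bounded_linear_compose)

lemma bounded_clinear_add:
  "bounded_clinear S \<Longrightarrow> bounded_clinear T \<Longrightarrow> bounded_clinear (\<lambda>x. S x + T x)"
  by (auto simp: bounded_clinear_def scaleC_add_right intro: bounded_linear_add)

lemma bounded_clinear_diff:
  "bounded_clinear S \<Longrightarrow> bounded_clinear T \<Longrightarrow> bounded_clinear (\<lambda>x. S x - T x)"
  by (auto simp: bounded_clinear_def scaleC_diff_right intro: bounded_linear_sub)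

lemma bounded_clinearI:
  assumes "\<And>x y. T (x + y) = T x + T y" "\<And>c x. T (c *\<^sub>C x) = c *\<^sub>C T x"
    "\<And>x. norm (T x) \<le> k * norm x"
  shows "bounded_clinear T"
  unfolding bounded_clinear_def
proof (intro conjI allI assms)
  show "bounded_linear T"
    by (rule bounded_linear_intro[of T k])
      (use assms in \<open>auto simp: mult.commute simp flip: scaleC_complex_of_real\<close>)
qed

section \<open>Closed convex sets and the adjoint\<close>

text \<open>A norm-minimizing sequence is Cauchy: midpoints stay in \<open>S\<close> and so have
  norm at least the infimum \<open>d\<close>, and the parallelogram law then bounds the distance of
  two members.\<close>

lemma closed_convex_min_norm:
  fixes S :: "'a::{real_inner,complete_space} set"
  assumes "closed S" "convex S" "S \<noteq> {}"
  obtains z where "z \<in> S" "\<And>x. x \<in> S \<Longrightarrow> norm z \<le> norm x"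
proof -
  define d where "d = Inf (norm ` S)"
  have d0: "0 \<le> d" unfolding d_def using assms(3) by (auto intro!: cINF_greatest)
  have d_le: "d \<le> norm x" if "x \<in> S" for x
    unfolding d_def using that by (intro cINF_lower bdd_belowI2[where m=0]) auto
  have "\<exists>x\<in>S. norm x < d + 1 / Suc n" for n
  proof -
    have "Inf (norm ` S) < d + 1 / Suc n" by (simp add: d_def)
    then show ?thesis
      using cInf_lessD[of "norm ` S"] assms(3) by blast
  qed
  then obtain u where u: "\<And>n. u n \<in> S" "\<And>n. norm (u n) < d + 1 / Suc n"
    by metis
  have par: "(norm (u m - u n))\<^sup>2 \<le> 2 * (norm (u m))\<^sup>2 + 2 * (norm (u n))\<^sup>2 - 4 * d\<^sup>2" for m n
  proof -
    have "(1/2) *\<^sub>R u m + (1/2) *\<^sub>R u n \<in> S"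
      using \<open>convex S\<close> u(1) by (auto intro: convexD)
    then have "d \<le> norm ((1/2) *\<^sub>R (u m + u n))"
      using d_le by (simp add: scaleR_add_right)
    then have "d\<^sup>2 \<le> (norm (u m + u n) / 2)\<^sup>2"
      using d0 by (intro power_mono) auto
    moreover have "(norm (u m - u n))\<^sup>2 + (norm (u m + u n))\<^sup>2 = 2 * (norm (u m))\<^sup>2 + 2 * (norm (u n))\<^sup>2"
      by (simp add: power2_norm_eq_inner inner_simps inner_commute)
    ultimately show ?thesis by (simp add: power_divide)
  qed
  have lim: "(\<lambda>n. norm (u n)) \<longlonglongrightarrow> d"
  proof (rule tendsto_sandwich[of "\<lambda>_. d" _ _ "\<lambda>n. d + 1 / Suc n"])
    show "(\<lambda>n. d + 1 / real (Suc n)) \<longlonglongrightarrow> d"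
      using tendsto_add[OF tendsto_const LIMSEQ_inverse_real_of_nat, of d]
      by (simp add: inverse_eq_divide)
  qed (use d_le u in \<open>auto intro!: always_eventually less_imp_le\<close>)
  have "Cauchy u"
  proof (rule CauchyI)
    fix e :: real assume "e > 0"
    have "(\<lambda>n. 4 * ((norm (u n))\<^sup>2 - d\<^sup>2)) \<longlonglongrightarrow> 4 * (d\<^sup>2 - d\<^sup>2)"
      by (intro tendsto_intros lim)
    then have "\<forall>\<^sub>F n in sequentially. 4 * ((norm (u n))\<^sup>2 - d\<^sup>2) < e\<^sup>2"
      using \<open>e > 0\<close> by (intro order_tendstoD(2)[where y="4 * (d\<^sup>2 - d\<^sup>2)"]) auto
    then obtain N where N: "\<And>n. n \<ge> N \<Longrightarrow> 4 * ((norm (u n))\<^sup>2 - d\<^sup>2) < e\<^sup>2"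
      by (auto simp: eventually_sequentially)
    show "\<exists>M. \<forall>m\<ge>M. \<forall>n\<ge>M. norm (u m - u n) < e"
    proof (intro exI allI impI)
      fix m n assume mn: "m \<ge> N" "n \<ge> N"
      have "(norm (u m - u n))\<^sup>2 < e\<^sup>2"
        using par[of m n] N[OF mn(1)] N[OF mn(2)] unfolding right_diff_distrib by argo
      then show "norm (u m - u n) < e"
        using \<open>e > 0\<close> by (meson less_imp_le power_less_imp_less_base)
    qed
  qed
  then obtain z where z: "u \<longlonglongrightarrow> z"
    by (auto simp: Cauchy_convergent_iff convergent_def)
  show thesis
  proof
    show "z \<in> S" using closed_sequentially[OF \<open>closed S\<close> u(1) z] .
    have "norm z = d" using LIMSEQ_unique[OF tendsto_norm[OF z] lim] .
    then show "\<And>x. x \<in> S \<Longrightarrow> norm z \<le> norm x" using d_le by simp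
  qed
qed

lemma inner_eq_zero_if_min_norm:
  fixes z w :: "'a::real_inner"
  assumes "\<And>t::real. norm z \<le> norm (z + t *\<^sub>R w)"
  shows "inner z w = 0"
proof (rule ccontr)
  assume n: "inner z w \<noteq> 0"
  then have w: "inner w w > 0" by (cases "w = 0") auto
  \<comment> \<open>This \<open>t\<close> minimizes the square of
    \<open>norm (z + t *\<^sub>R w)\<close>.\<close>
  define t where "t = - inner z w / inner w w"
  have "inner z z \<le> inner (z + t *\<^sub>R w) (z + t *\<^sub>R w)"
    using assms[of t] by (simp add: norm_le)
  then have "0 \<le> 2 * t * inner z w + t * t * inner w w"
    by (simp add: inner_simps inner_commute algebra_simps)
  also have "\<dots> = - ((inner z w)\<^sup>2 / inner w w)"
    using w by (simp add: t_def field_simps power2_eq_square)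
  finally show False
    using n w by (smt (verit) divide_pos_pos zero_less_power2)
qed

text \<open>If \<open>f\<close> is nonzero, the point \<open>z\<close> of least norm on the
  hyperplane \<open>f = 1\<close> is orthogonal to the kernel of \<open>f\<close>; splitting
  \<open>x\<close> along \<open>z\<close> and the kernel shows that a multiple of \<open>z\<close>
  represents \<open>f\<close>.\<close>

lemma riesz_representation:
  fixes f :: "'a::{real_inner,complete_space} \<Rightarrow> real"
  assumes "bounded_linear f"
  obtains z where "\<And>x. f x = inner x z"
proof (cases "\<forall>x. f x = 0")
  case True
  then show thesis using that[of 0] by simp
next
  case False
  interpret bounded_linear f by fact
  from False obtain x0 where x0: "f x0 \<noteq> 0" by blast
  define S where "S = f -` {1}"
  have "closed S" unfolding S_def
    by (intro continuous_closed_vimage continuous_at linear_continuous_at assms closed_singleton)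
  moreover have "convex S"
    by (rule convexI) (auto simp: S_def add scaleR)
  moreover have "(1 / f x0) *\<^sub>R x0 \<in> S"
    using x0 by (simp add: S_def scaleR)
  ultimately obtain z where z: "z \<in> S" "\<And>x. x \<in> S \<Longrightarrow> norm z \<le> norm x"
    using closed_convex_min_norm by blast
  have fz: "f z = 1" using z(1) by (simp add: S_def)
  have orth: "inner z w = 0" if "f w = 0" for w
  proof (rule inner_eq_zero_if_min_norm)
    fix t :: real
    have "f (z + t *\<^sub>R w) = 1"
      using that fz by (simp add: add scaleR)
    then show "norm z \<le> norm (z + t *\<^sub>R w)"
      by (intro z(2)) (simp add: S_def)
  qed
  have "z \<noteq> 0" using fz zero by auto
  then have zz: "inner z z \<noteq> 0" by simp
  show thesis
  proof (rule that)
    fix x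
    have "inner z (x - f x *\<^sub>R z) = 0"
      by (rule orth) (simp add: diff scaleR fz)
    then have "inner z x = f x * inner z z"
      by (simp add: inner_diff_right)
    then show "f x = inner x ((1 / inner z z) *\<^sub>R z)"
      using zz by (simp add: inner_commute)
  qed
qed

text \<open>Shows that the definite description in \<open>cadjoint\<close> denotes. Riesz
  representation of \<open>inner (T x) y\<close> as a functional of \<open>x\<close> gives a
  candidate, and \<open>cinner_eqI\<close> carries it over to the complex inner product. Uniqueness
  is visible already on real parts.\<close>

lemma cinner_cadjoint:
  fixes T :: "'a::chilbert_space \<Rightarrow> 'b::chilbert_space"
  assumes "bounded_clinear T"
  shows "cinner (T x) y = cinner x (cadjoint T y)"
proof -
  have bl: "bounded_linear T" and sc: "\<And>c x. T (c *\<^sub>C x) = c *\<^sub>C T x"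
    using assms by (auto simp: bounded_clinear_def)
  have "\<exists>z. \<forall>x. inner (T x) y = inner x z" for y
    using riesz_representation[OF bounded_linear_inner_left_comp[OF bl, of y]] by metis
  then obtain S where S: "\<And>x y. inner (T x) y = inner x (S y)" by metis
  have "\<forall>x y. cinner (T x) y = cinner x (cadjoint T y)"
    unfolding cadjoint_def
  proof (rule theI[of _ S])
    show "\<forall>x y. cinner (T x) y = cinner x (S y)"
      using cinner_eqI[of T _ "S _"] S sc by blast
  next
    fix S' assume "\<forall>x y. cinner (T x) y = cinner x (S' y)"
    then have "inner x (S' y) = inner x (S y)" for x y
      by (metis S inner_eq_Re_cinner)
    then have "inner (S' y - S y) (S' y - S y) = 0" for y
      by (simp add: inner_diff_right)
    then show "S' = S" by (simp add: fun_eq_iff)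
  qed
  then show ?thesis by blast
qed

lemma inner_cadjoint: "bounded_clinear T \<Longrightarrow> inner (T x) y = inner x (cadjoint T y)"
  by (simp add: inner_eq_Re_cinner cinner_cadjoint)

lemma inner_left_eqI: "(\<And>z. inner z x = inner z y) \<Longrightarrow> x = y"
  by (metis inner_commute vector_eq_rdot)

lemma bounded_clinear_cadjoint:
  fixes T :: "'a::chilbert_space \<Rightarrow> 'b::chilbert_space"
  assumes T: "bounded_clinear T"
  shows "bounded_clinear (cadjoint T)"
proof (rule bounded_clinearI)
  fix x y :: 'b and c :: complex
  show "cadjoint T (x + y) = cadjoint T x + cadjoint T y"
    by (rule inner_left_eqI) (simp add: inner_add_right flip: inner_cadjoint[OF T])
  show "cadjoint T (c *\<^sub>C x) = c *\<^sub>C cadjoint T x"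
    by (rule inner_left_eqI)
      (simp add: inner_eq_Re_cinner cinner_scaleC_right flip: cinner_cadjoint[OF T])
  have bl: "bounded_linear T" using T by (simp add: bounded_clinear_def)
  \<comment> \<open>Testing against \<open>cadjoint T x\<close> itself bounds the adjoint by
    \<open>onorm T\<close>.\<close>
  have "norm (cadjoint T x) * norm (cadjoint T x) = inner (T (cadjoint T x)) x"
    by (simp add: inner_cadjoint[OF T] flip: power2_norm_eq_inner power2_eq_square)
  also have "\<dots> \<le> norm (T (cadjoint T x)) * norm x"
    by (rule norm_cauchy_schwarz)
  also have "\<dots> \<le> onorm T * norm (cadjoint T x) * norm x"
    by (intro mult_right_mono onorm bl) auto
  finally show "norm (cadjoint T x) \<le> onorm T * norm x"
    using onorm_pos_le[OF bl] by (cases "cadjoint T x = 0") (auto simp: mult_ac)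
qed

section \<open>Density through orthogonality\<close>

lemma subspace_closure:
  fixes D :: "'a::real_normed_vector set"
  assumes "subspace D"
  shows "subspace (closure D)"
proof (rule subspaceI)
  show "0 \<in> closure D" using subspace_0[OF assms] closure_subset by blast
next
  fix x y assume "x \<in> closure D" "y \<in> closure D"
  then obtain u v where "\<And>n. u n \<in> D" "u \<longlonglongrightarrow> x" "\<And>n. v n \<in> D" "v \<longlonglongrightarrow> y"
    unfolding closure_sequential by blast
  then show "x + y \<in> closure D"
    unfolding closure_sequential
    by (intro exI[of _ "\<lambda>n. u n + v n"]) (auto intro: tendsto_add subspace_add[OF assms])
next
  fix x and c :: real assume "x \<in> closure D"
  then obtain u where "\<And>n. u n \<in> D" "u \<longlonglongrightarrow> x"
    unfolding closure_sequential by blast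
  then show "c *\<^sub>R x \<in> closure D"
    unfolding closure_sequential
    by (intro exI[of _ "\<lambda>n. c *\<^sub>R u n"]) (auto intro: tendsto_scaleR subspace_scale[OF assms])
qed

text \<open>The least-norm element of the coset \<open>y + closure D\<close> is orthogonal to
  \<open>D\<close>, hence zero, so \<open>y\<close> itself lies in \<open>closure D\<close>.\<close>

lemma dense_if_orthogonal_trivial:
  fixes D :: "'a::{real_inner,complete_space} set"
  assumes "subspace D" and orth: "\<And>y. (\<And>x. x \<in> D \<Longrightarrow> inner x y = 0) \<Longrightarrow> y = 0"
  shows "closure D = UNIV"
proof (rule ccontr)
  assume "closure D \<noteq> UNIV"
  then obtain y where y: "y \<notin> closure D" by blast
  define S where "S = (\<lambda>x. y + x) ` closure D"
  have sub: "subspace (closure D)" using assms(1) by (rule subspace_closure)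
  have "closed S" "convex S" "S \<noteq> {}"
    using sub subspace_0[OF sub] unfolding S_def
    by (auto intro: closed_translation convex_translation subspace_imp_convex)
  then obtain z where z: "z \<in> S" "\<And>x. x \<in> S \<Longrightarrow> norm z \<le> norm x"
    using closed_convex_min_norm by blast
  from z(1) obtain v where v: "v \<in> closure D" "z = y + v" by (auto simp: S_def)
  have "z = 0"
  proof (rule orth)
    fix x assume "x \<in> D"
    then have xc: "x \<in> closure D" using closure_subset by blast
    have "inner z x = 0"
    proof (rule inner_eq_zero_if_min_norm)
      fix t :: real
      have "v + t *\<^sub>R x \<in> closure D"
        using sub v xc by (intro subspace_add subspace_scale)
      then show "norm z \<le> norm (z + t *\<^sub>R x)"
        by (intro z(2)) (auto simp: S_def v add.assoc)
    qed
    then show "inner x z = 0" by (simp add: inner_commute)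
  qed
  then have "y = - v" using v by (simp add: eq_neg_iff_add_eq_0)
  then show False using y v(1) subspace_neg[OF sub] by auto
qed

section \<open>The method of continuity\<close>

text \<open>The lower bound makes the inverse \<open>R\<close> of \<open>T\<close> Lipschitz with
  constant \<open>1 / m\<close>, so mapping \<open>y\<close> to \<open>R (f - B y)\<close> is a
  contraction with factor \<open>k / m\<close>, and its fixed point solves the equation.\<close>

lemma perturb_surj:
  fixes T B :: "'a::banach \<Rightarrow> 'a"
  assumes T: "linear T" "surj T" "\<And>y. m * norm y \<le> norm (T y)"
    and B: "\<And>x y. norm (B x - B y) \<le> k * norm (x - y)" and "0 \<le> k" "k < m"
  shows "\<exists>y. T y + B y = f"
proof -
  define R where "R = inv T"
  have TR: "T (R y) = y" for y
    unfolding R_def using T(2) by (rule surj_f_inv_f)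
  have m: "m > 0" using assms by linarith
  have R: "norm (R x - R y) \<le> norm (x - y) / m" for x y
    using T(3)[of "R x - R y"] m
    by (simp add: linear_diff[OF T(1)] TR field_simps)
  have "\<exists>!y. R (f - B y) = y"
  proof (rule banach_fix_type[of "k / m"])
    show "0 \<le> k / m" "k / m < 1" using assms m by auto
    show "\<forall>x y. dist (R (f - B x)) (R (f - B y)) \<le> k / m * dist x y"
    proof (intro allI)
      fix x y
      have "norm (R (f - B x) - R (f - B y)) \<le> norm (B y - B x) / m"
        using R[of "f - B x" "f - B y"] by (simp add: algebra_simps)
      also have "\<dots> \<le> k * norm (y - x) / m"
        using B m by (intro divide_right_mono) auto
      finally show "dist (R (f - B x)) (R (f - B y)) \<le> k / m * dist x y"
        by (simp add: dist_norm norm_minus_commute)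
    qed
  qed
  then obtain y where "R (f - B y) = y" by blast
  then have "T y = f - B y" using TR by metis
  then show ?thesis by (metis diff_add_cancel)
qed

text \<open>The weight \<open>t\<close> admits a priori bounds that degenerate as \<open>t\<close>
  tends to zero, as in \<open>coupled_surj\<close>. For small \<open>t\<close> the identity
  dominates \<open>t B\<close>, so all the maps \<open>1 + t B\<close> share one lower bound, and
  finitely many applications of \<open>perturb_surj\<close> lead from \<open>t = 0\<close> to
  \<open>t = 1\<close>.\<close>

lemma continuity_method:
  fixes B :: "'a::banach \<Rightarrow> 'a"
  assumes B: "bounded_linear B"
    and c: "\<And>t y. 0 < t \<Longrightarrow> t \<le> 1 \<Longrightarrow> t * norm y \<le> c * norm (y + t *\<^sub>R B y)"
  shows "\<exists>y. y + B y = f"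
proof -
  interpret bounded_linear B by fact
  define k where "k = onorm B + 1"
  have kp: "k \<ge> 1" unfolding k_def using onorm_pos_le[OF B] by simp
  have k: "norm (B x) \<le> k * norm x" for x
    using onorm[OF B, of x] by (simp add: k_def distrib_right add_increasing2)
  define c' where "c' = max c 1"
  \<comment> \<open>The value \<open>1/2\<close> serves the range
    \<open>t \<le> 1 / (2 * k)\<close>; the other value serves the larger \<open>t\<close>, where
    the a priori bound is used.\<close>
  define m where "m = min (1/2) (1 / (2 * k * c'))"
  have c': "c' \<ge> 1" "c \<le> c'" by (auto simp: c'_def)
  have m: "m > 0" using kp c' by (auto simp: m_def)
  have low: "m * norm y \<le> norm (y + t *\<^sub>R B y)" if t: "0 \<le> t" "t \<le> 1" for t y
  proof (cases "t \<le> 1 / (2 * k)")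
    case True
    have "norm (t *\<^sub>R B y) \<le> 1 / (2 * k) * (k * norm y)"
      using True t kp k[of y] by (simp only: norm_scaleR) (intro mult_mono, auto)
    then have "norm (t *\<^sub>R B y) \<le> norm y / 2" using kp by simp
    moreover have "norm y - norm (t *\<^sub>R B y) \<le> norm (y + t *\<^sub>R B y)"
      using norm_diff_ineq by blast
    moreover have "m * norm y \<le> 1/2 * norm y"
      by (intro mult_right_mono) (auto simp: m_def)
    ultimately show ?thesis by linarith
  next
    case False
    then have "t > 0" using kp by (smt (verit) divide_nonneg_nonneg)
    have "1 / (2 * k) * norm y \<le> t * norm y"
      using False by (intro mult_right_mono) auto
    also have "\<dots> \<le> c * norm (y + t *\<^sub>R B y)" using c \<open>t > 0\<close> t by blast
    also have "\<dots> \<le> c' * norm (y + t *\<^sub>R B y)" using c' by (intro mult_right_mono) auto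
    finally have "1 / (2 * k * c') * norm y \<le> norm (y + t *\<^sub>R B y)"
      using c' kp by (simp add: field_simps)
    moreover have "m * norm y \<le> 1 / (2 * k * c') * norm y"
      by (intro mult_right_mono) (auto simp: m_def)
    ultimately show ?thesis by linarith
  qed
  \<comment> \<open>With this many steps each increment has Lipschitz constant \<open>k / N\<close>,
    below the common lower bound \<open>m\<close>.\<close>
  obtain N :: nat where N: "N > 0" "k / m < N"
    using reals_Archimedean2[of "k / m"] m kp
    by (metis divide_nonneg_pos gr0I less_le_not_le of_nat_0 order.trans zero_le_one)
  have step: "j \<le> N \<Longrightarrow> surj (\<lambda>y. y + (j / N) *\<^sub>R B y)" for j :: nat
  proof (induction j)
    case 0
    show ?case by simp
  next
    case (Suc j)
    show ?case
    proof (unfold surj_def, intro allI)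
      fix f
      have "\<exists>y. (y + (j / N) *\<^sub>R B y) + (1 / N) *\<^sub>R B y = f"
      proof (rule perturb_surj[where k = "k / N" and m = m])
        show "linear (\<lambda>y. y + (real j / real N) *\<^sub>R B y)"
          by (rule linearI) (auto simp: add scaleR algebra_simps)
        show "surj (\<lambda>y. y + (real j / real N) *\<^sub>R B y)" using Suc by simp
        show "m * norm y \<le> norm (y + (real j / real N) *\<^sub>R B y)" for y
          using Suc.prems N by (intro low) auto
        show "norm ((1 / real N) *\<^sub>R B x - (1 / real N) *\<^sub>R B y) \<le> k / real N * norm (x - y)" for x y
        proof -
          have "norm ((1 / real N) *\<^sub>R B x - (1 / real N) *\<^sub>R B y) = (1 / real N) * norm (B (x - y))"
            using N(1) by (simp add: diff flip: scaleR_diff_right)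
          also have "\<dots> \<le> (1 / real N) * (k * norm (x - y))"
            by (intro mult_left_mono k) auto
          finally show ?thesis by simp
        qed
        show "0 \<le> k / real N" "k / real N < m"
          using kp N m by (auto simp: field_simps)
      qed
      then obtain y where y: "(y + (j / N) *\<^sub>R B y) + (1 / N) *\<^sub>R B y = f" ..
      have y': "y + (real (Suc j) / N) *\<^sub>R B y = f"
        using y by (simp add: add_divide_distrib scaleR_add_left algebra_simps)
      show "\<exists>y. f = y + (real (Suc j) / N) *\<^sub>R B y"
        by (rule exI) (rule y'[symmetric])
    qed
  qed
  have "surj (\<lambda>y. y + B y)" using step[of N] N by simp
  then show ?thesis by (metis surjD)
qed

section \<open>Generation of contraction semigroups\<close>

lemma clinear_on_0: "clinear_on D A \<Longrightarrow> 0 \<in> D \<and> A 0 = 0"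
  unfolding clinear_on_def by (metis scaleC_zero_left)

lemma clinear_on_add: "clinear_on D A \<Longrightarrow> x \<in> D \<Longrightarrow> y \<in> D \<Longrightarrow> x + y \<in> D \<and> A (x + y) = A x + A y"
  by (simp add: clinear_on_def)

lemma clinear_on_scaleC: "clinear_on D A \<Longrightarrow> x \<in> D \<Longrightarrow> c *\<^sub>C x \<in> D \<and> A (c *\<^sub>C x) = c *\<^sub>C A x"
  by (simp add: clinear_on_def)

lemma clinear_on_scaleR: "clinear_on D A \<Longrightarrow> x \<in> D \<Longrightarrow> r *\<^sub>R x \<in> D \<and> A (r *\<^sub>R x) = r *\<^sub>R A x"
  using clinear_on_scaleC[of D A x "complex_of_real r"] by (simp add: scaleC_complex_of_real)

lemma clinear_on_minus: "clinear_on D A \<Longrightarrow> x \<in> D \<Longrightarrow> - x \<in> D \<and> A (- x) = - A x"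
  using clinear_on_scaleR[of D A x "- 1"] by simp

lemma clinear_on_diff: "clinear_on D A \<Longrightarrow> x \<in> D \<Longrightarrow> y \<in> D \<Longrightarrow> x - y \<in> D \<and> A (x - y) = A x - A y"
  using clinear_on_add[of D A x "- y"] clinear_on_minus[of D A y] by simp

lemma clinear_on_subspace: "clinear_on D A \<Longrightarrow> subspace D"
  by (auto intro: subspaceI simp: clinear_on_0 clinear_on_add clinear_on_scaleR)

lemma dense_approx:
  fixes x :: "'a::real_normed_vector"
  assumes "closure V = UNIV" "0 < e"
  obtains z where "z \<in> V" "norm (z - x) < e"
  using assms closure_approachable[of x V] by (auto simp: dist_norm)

text \<open>An arbitrary \<open>x\<close> is replaced by a nearby element of \<open>V\<close> at a
  cost that is uniform in \<open>n\<close>, because every \<open>T n\<close> is a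
  contraction.\<close>

lemma contractions_convergent:
  fixes T :: "nat \<Rightarrow> 'a::banach \<Rightarrow> 'a"
  assumes lin: "\<And>n. linear (T n)" and con: "\<And>n x. norm (T n x) \<le> norm x"
    and V: "closure V = UNIV" "\<And>x. x \<in> V \<Longrightarrow> convergent (\<lambda>n. T n x)"
  shows "convergent (\<lambda>n. T n x)"
proof -
  have "Cauchy (\<lambda>n. T n x)"
  proof (rule CauchyI)
    fix e :: real assume "e > 0"
    then obtain v where v: "v \<in> V" "norm (v - x) < e / 3"
      using dense_approx[OF V(1), of "e / 3" x] by auto
    obtain M where M: "\<And>m n. m \<ge> M \<Longrightarrow> n \<ge> M \<Longrightarrow> norm (T m v - T n v) < e / 3"
      using CauchyD[OF convergent_Cauchy[OF V(2)[OF v(1)]], of "e / 3"] \<open>e > 0\<close> by auto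
    show "\<exists>M. \<forall>m\<ge>M. \<forall>n\<ge>M. norm (T m x - T n x) < e"
    proof (intro exI allI impI)
      fix m n assume "m \<ge> M" "n \<ge> M"
      have "T m x - T n x = T m (x - v) + (T m v - T n v) + T n (v - x)"
        by (simp add: linear_diff[OF lin])
      then have "norm (T m x - T n x) \<le> norm (T m (x - v)) + norm (T m v - T n v) + norm (T n (v - x))"
        by (metis norm_triangle_ineq norm_triangle_mono order_refl)
      also have "\<dots> < e"
        using con[of m "x - v"] con[of n "v - x"] v M[OF \<open>m \<ge> M\<close> \<open>n \<ge> M\<close>]
        by (simp add: norm_minus_commute)
      finally show "norm (T m x - T n x) < e" .
    qed
  qed
  then show ?thesis by (simp add: Cauchy_convergent_iff)
qed

section \<open>M-dissipative operators and the implicit Euler step\<close>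

locale m_dissipative =
  fixes D :: "'a::chilbert_space set" and A :: "'a \<Rightarrow> 'a"
  assumes lin: "clinear_on D A"
    and dissipative: "\<And>x. x \<in> D \<Longrightarrow> inner (A x) x \<le> 0"
    and range: "\<And>h y. 0 < h \<Longrightarrow> \<exists>x\<in>D. x - h *\<^sub>R A x = y"
begin

text \<open>The step \<open>(1 - h A)^-1\<close>. For \<open>h = 0\<close> its defining equation has
  a solution only if \<open>y\<close> lies in \<open>D\<close>, so the identity is put there by
  hand, which lets time zero be treated along with the other times.\<close>

definition euler :: "real \<Rightarrow> 'a \<Rightarrow> 'a"
  where "euler h y = (if h = 0 then y else (SOME x. x \<in> D \<and> x - h *\<^sub>R A x = y))"

lemma A_diff: "x \<in> D \<Longrightarrow> y \<in> D \<Longrightarrow> x - y \<in> D \<and> A (x - y) = A x - A y"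
  and A_add: "x \<in> D \<Longrightarrow> y \<in> D \<Longrightarrow> x + y \<in> D \<and> A (x + y) = A x + A y"
  and A_scaleC: "x \<in> D \<Longrightarrow> c *\<^sub>C x \<in> D \<and> A (c *\<^sub>C x) = c *\<^sub>C A x"
  and A_scaleR: "x \<in> D \<Longrightarrow> r *\<^sub>R x \<in> D \<and> A (r *\<^sub>R x) = r *\<^sub>R A x"
  using lin by (auto simp: clinear_on_diff clinear_on_add clinear_on_scaleC clinear_on_scaleR)

text \<open>Pairing \<open>x - h A x\<close> with \<open>x\<close> leaves the square of
  \<open>norm x\<close> plus a nonnegative term. Both uniqueness and contractivity of the Euler step
  come from this.\<close>

lemma norm_le_resolvent:
  assumes "x \<in> D" "0 \<le> h"
  shows "norm x \<le> norm (x - h *\<^sub>R A x)"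
proof (cases "x = 0")
  case False
  have "norm x * norm x \<le> inner (x - h *\<^sub>R A x) x"
    using dissipative[OF assms(1)] assms(2)
    by (simp add: inner_diff_left mult_nonneg_nonpos flip: power2_eq_square power2_norm_eq_inner)
  also have "\<dots> \<le> norm (x - h *\<^sub>R A x) * norm x" by (rule norm_cauchy_schwarz)
  finally show ?thesis using False by simp
qed simp

lemma euler:
  assumes "0 < h"
  shows "euler h y \<in> D \<and> euler h y - h *\<^sub>R A (euler h y) = y"
proof -
  have "\<exists>x. x \<in> D \<and> x - h *\<^sub>R A x = y" using range[OF assms, of y] by blast
  from someI_ex[OF this] show ?thesis using assms by (simp add: euler_def)
qed

lemma euler_0 [simp]: "euler 0 y = y"
  by (simp add: euler_def)

lemma euler_unique:
  assumes "0 \<le> h" "x \<in> D" "x - h *\<^sub>R A x = y"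
  shows "euler h y = x"
proof (cases "h = 0")
  case True
  then show ?thesis using assms by simp
next
  case False
  then have e: "euler h y \<in> D" "euler h y - h *\<^sub>R A (euler h y) = y"
    using euler assms(1) by auto
  have "norm (euler h y - x) \<le> norm (euler h y - x - h *\<^sub>R A (euler h y - x))"
    using e assms by (intro norm_le_resolvent) (auto simp: A_diff)
  also have "euler h y - x - h *\<^sub>R A (euler h y - x)
      = (euler h y - h *\<^sub>R A (euler h y)) - (x - h *\<^sub>R A x)"
    using e(1) assms(2) by (simp add: A_diff scaleR_diff_right)
  finally show ?thesis by (simp only: e(2) assms(3)) simp
qed

lemma norm_euler_le: "0 \<le> h \<Longrightarrow> norm (euler h y) \<le> norm y"
  using norm_le_resolvent[of "euler h y" h] euler[of h y] by (cases "h = 0") auto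

lemma euler_add: assumes "0 \<le> h" shows "euler h (x + y) = euler h x + euler h y"
proof (cases "h = 0")
  case False
  then have "0 < h" using assms by simp
  have x: "euler h x \<in> D" "euler h x - h *\<^sub>R A (euler h x) = x"
    and y: "euler h y \<in> D" "euler h y - h *\<^sub>R A (euler h y) = y"
    using euler[OF \<open>0 < h\<close>] by auto
  have "euler h x + euler h y - h *\<^sub>R A (euler h x + euler h y)
      = (euler h x - h *\<^sub>R A (euler h x)) + (euler h y - h *\<^sub>R A (euler h y))"
    using A_add[OF x(1) y(1)] by (simp add: scaleR_add_right)
  then show ?thesis
    using A_add[OF x(1) y(1)] unfolding x(2) y(2) by (intro euler_unique assms) auto
qed simp

lemma euler_scaleC: assumes "0 \<le> h" shows "euler h (c *\<^sub>C x) = c *\<^sub>C euler h x"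
proof (cases "h = 0")
  case False
  then have "0 < h" using assms by simp
  show ?thesis
    using euler[OF \<open>0 < h\<close>, of x]
    by (intro euler_unique assms) (auto simp: A_scaleC simp flip: scaleC_scaleR scaleC_diff_right)
qed simp

lemma euler_dom: "0 < h \<Longrightarrow> euler h y \<in> D"
  using euler by blast

text \<open>For \<open>h > 0\<close> the equation of the step writes \<open>A (euler h x)\<close> as
  a difference quotient of \<open>euler h x\<close> and \<open>x\<close>, both in \<open>D\<close>;
  applying \<open>A\<close> once more yields the equation that characterizes
  \<open>euler h (A x)\<close>.\<close>

lemma euler_A:
  assumes "0 \<le> h" "x \<in> D"
  shows "euler h x \<in> D" "A (euler h x) = euler h (A x)" "euler h x - x = h *\<^sub>R euler h (A x)"
proof -
  have "euler h x \<in> D \<and> A (euler h x) = euler h (A x) \<and> euler h x - x = h *\<^sub>R euler h (A x)"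
  proof (cases "h = 0")
    case False
    then have h: "0 < h" using assms by simp
    let ?y = "euler h x"
    have y: "?y \<in> D" "?y - h *\<^sub>R A ?y = x" using euler[OF h] by auto
    have Ay: "A ?y = (1 / h) *\<^sub>R (?y - x)"
    proof -
      have "?y - x = h *\<^sub>R A ?y" using y(2) by (metis add_diff_cancel_left' diff_add_cancel)
      then show ?thesis using h by simp
    qed
    have "?y - x \<in> D" using y assms by (simp add: A_diff)
    then have AyD: "A ?y \<in> D" "A (A ?y) = (1/h) *\<^sub>R (A ?y - A x)"
      unfolding Ay using y assms by (auto simp: A_scaleR A_diff Ay)
    have "A ?y - h *\<^sub>R A (A ?y) = A x" using h AyD by simp
    then have "euler h (A x) = A ?y" using AyD assms by (intro euler_unique)
    then show ?thesis using y by (metis add_diff_cancel_left' diff_add_cancel)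
  qed (use assms in simp)
  then show "euler h x \<in> D" "A (euler h x) = euler h (A x)" "euler h x - x = h *\<^sub>R euler h (A x)"
    by auto
qed

text \<open>Applying \<open>euler h\<close> to the equation of \<open>euler k y\<close> gives the
  equation of \<open>euler k (euler h y)\<close>, since \<open>euler h\<close> commutes with
  \<open>A\<close> on \<open>D\<close>.\<close>

lemma euler_commute:
  assumes "0 \<le> h" "0 \<le> k"
  shows "euler h (euler k y) = euler k (euler h y)"
proof (cases "k = 0")
  case False
  then have k: "0 < k" using assms by simp
  let ?w = "euler k y"
  have w: "?w \<in> D" "?w - k *\<^sub>R A ?w = y" using euler[OF k] by auto
  have "euler h (- (k *\<^sub>R A ?w)) = - (k *\<^sub>R euler h (A ?w))"
    using euler_scaleC[OF assms(1), of "complex_of_real (- k)" "A ?w"]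
    by (simp only: scaleC_complex_of_real scaleR_minus_left)
  then have "euler h ?w - k *\<^sub>R A (euler h ?w) = euler h y"
    using euler_add[OF assms(1), of ?w "- (k *\<^sub>R A ?w)"] w euler_A(2)[OF assms(1) w(1)] by simp
  then show ?thesis
    using euler_A(1)[OF assms(1) w(1)] euler_unique assms(2) by metis
qed simp

lemma linear_euler: "0 \<le> h \<Longrightarrow> linear (euler h)"
  using euler_scaleC[of h "complex_of_real _"]
  by (intro linearI) (auto simp: euler_add scaleC_complex_of_real)

definition dom_sq :: "'a set" where "dom_sq = {x \<in> D. A x \<in> D}"

text \<open>The product \<open>(1 - a A)(1 - b A)\<close> exceeds \<open>1 - (a + b) A\<close> by
  \<open>a b A^2\<close>. So the difference of the two results is, up to sign, the contraction
  \<open>euler (a + b)\<close> applied to \<open>a b A^2 p\<close>, where \<open>p\<close> is the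
  result of the two steps.\<close>

lemma euler_step:
  assumes "0 \<le> a" "0 \<le> b" "x \<in> dom_sq"
  shows "norm (euler a (euler b x) - euler (a + b) x) \<le> a * b * norm (A (A x))"
proof -
  have x: "x \<in> D" "A x \<in> D" using assms by (auto simp: dom_sq_def)
  let ?q = "euler b x" and ?r = "euler (a + b) x"
  let ?p = "euler a ?q"
  have D: "?q \<in> D" "?p \<in> D" "?r \<in> D" using x assms by (auto intro!: euler_A(1))
  have Aq: "A ?q = euler b (A x)" "A ?q \<in> D" "A (A ?q) = euler b (A (A x))"
    using x assms by (auto simp: euler_A)
  have Ap: "A ?p = euler a (A ?q)" "A ?p \<in> D" "A (A ?p) = euler a (euler b (A (A x)))"
    using Aq D assms by (auto simp: euler_A)
  have q: "?q - b *\<^sub>R A ?q = x"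
    using assms euler[of b x] by (cases "b = 0") auto
  have p: "?p - a *\<^sub>R A ?p = ?q"
    using assms euler[of a ?q] by (cases "a = 0") auto
  have r: "?r - (a + b) *\<^sub>R A ?r = x"
    using assms euler[of "a + b" x] by (cases "a + b = 0") auto
  have "A ?q = A ?p - a *\<^sub>R A (A ?p)"
    using D Ap(2) by (subst p[symmetric]) (auto simp: A_diff A_scaleR)
  with p q have "?p - a *\<^sub>R A ?p - b *\<^sub>R (A ?p - a *\<^sub>R A (A ?p)) = x" by simp
  then have x': "x = ?p - (a + b) *\<^sub>R A ?p + (a * b) *\<^sub>R A (A ?p)"
    by (simp add: algebra_simps)
  have "(?p - ?r) - (a + b) *\<^sub>R A (?p - ?r) = (?p - (a + b) *\<^sub>R A ?p) - (?r - (a + b) *\<^sub>R A ?r)"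
    using D by (simp add: A_diff scaleR_diff_right)
  also have "\<dots> = (?p - (a + b) *\<^sub>R A ?p) - x" using r by simp
  also have "\<dots> = - ((a * b) *\<^sub>R A (A ?p))" by (subst x') simp
  finally have eq: "(?p - ?r) - (a + b) *\<^sub>R A (?p - ?r) = - ((a * b) *\<^sub>R A (A ?p))" .
  have "norm (?p - ?r) \<le> norm ((?p - ?r) - (a + b) *\<^sub>R A (?p - ?r))"
    using D assms by (intro norm_le_resolvent) (auto simp: A_diff)
  also have "\<dots> = a * b * norm (A (A ?p))" unfolding eq using assms by simp
  also have "\<dots> \<le> a * b * norm (A (A x))"
    unfolding Ap(3) using assms
    by (intro mult_left_mono order_trans[OF norm_euler_le norm_euler_le]) auto
  finally show ?thesis .
qed

section \<open>Powers of the Euler step\<close>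

lemma euler_pow_A:
  assumes "0 \<le> h" "x \<in> D"
  shows "(euler h ^^ n) x \<in> D \<and> A ((euler h ^^ n) x) = (euler h ^^ n) (A x)"
  using assms by (induction n) (auto simp: euler_A)

lemma euler_pow_dom_sq:
  "0 \<le> h \<Longrightarrow> x \<in> dom_sq \<Longrightarrow>
    (euler h ^^ n) x \<in> dom_sq \<and> A (A ((euler h ^^ n) x)) = (euler h ^^ n) (A (A x))"
  by (simp add: dom_sq_def euler_pow_A)

lemma norm_euler_pow_le: "0 \<le> h \<Longrightarrow> norm ((euler h ^^ n) x) \<le> norm x"
  by (induction n) (auto intro: order_trans[OF norm_euler_le])

lemma euler_pow_add: "0 \<le> h \<Longrightarrow> (euler h ^^ n) (x + y) = (euler h ^^ n) x + (euler h ^^ n) y"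
  by (induction n) (auto simp: euler_add)

lemma euler_pow_scaleC: "0 \<le> h \<Longrightarrow> (euler h ^^ n) (c *\<^sub>C x) = c *\<^sub>C (euler h ^^ n) x"
  by (induction n) (auto simp: euler_scaleC)

text \<open>The errors of the single steps only add up: each is propagated by contractions, and each
  is at most \<open>a * b * norm (A (A x))\<close> because \<open>A\<close> commutes with the powers
  of \<open>euler (a + b)\<close>.\<close>

lemma euler_steps:
  assumes ab: "0 \<le> a" "0 \<le> b" and x: "x \<in> dom_sq"
  shows "norm (((euler a \<circ> euler b) ^^ n) x - (euler (a + b) ^^ n) x) \<le> n * (a * b) * norm (A (A x))"
proof (induction n)
  case (Suc n)
  let ?P = "euler a \<circ> euler b" and ?Q = "euler (a + b)"
  let ?u = "(?P ^^ n) x" and ?v = "(?Q ^^ n) x"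
  have v: "?v \<in> dom_sq" "A (A ?v) = (?Q ^^ n) (A (A x))" using euler_pow_dom_sq ab x by auto
  have "?P ?u - ?Q ?v = ?P (?u - ?v) + (?P ?v - ?Q ?v)"
    using ab by (simp add: linear_diff[OF linear_euler])
  then have "norm (?P ?u - ?Q ?v) \<le> norm (?P (?u - ?v)) + norm (?P ?v - ?Q ?v)"
    by (metis norm_triangle_ineq)
  moreover have "norm (?P (?u - ?v)) \<le> norm (?u - ?v)"
    using ab by (auto intro!: order_trans[OF norm_euler_le norm_euler_le])
  moreover have "norm (?P ?v - ?Q ?v) \<le> a * b * norm (A (A ?v))"
    using euler_step[OF ab v(1)] by simp
  moreover have "\<dots> \<le> a * b * norm (A (A x))"
    unfolding v(2) using ab by (intro mult_left_mono norm_euler_pow_le) auto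
  ultimately have "norm (?P ?u - ?Q ?v) \<le> n * (a * b) * norm (A (A x)) + a * b * norm (A (A x))"
    using Suc by linarith
  moreover have "(?P ^^ Suc n) x = ?P ?u" "(?Q ^^ Suc n) x = ?Q ?v" by simp_all
  ultimately show ?case by (simp only: of_nat_Suc) (simp only: distrib_right mult_1_left add.commute)
qed simp

lemma euler_pow_diff_le:
  assumes "0 \<le> h" "x \<in> D"
  shows "norm ((euler h ^^ n) x - x) \<le> n * h * norm (A x)"
proof (induction n)
  case (Suc n)
  have "(euler h ^^ Suc n) x - x = euler h ((euler h ^^ n) x - x) + (euler h x - x)"
    using assms by (simp add: linear_diff[OF linear_euler])
  then have "norm ((euler h ^^ Suc n) x - x) \<le> norm (euler h ((euler h ^^ n) x - x)) + norm (euler h x - x)"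
    by (metis norm_triangle_ineq)
  also have "norm (euler h ((euler h ^^ n) x - x)) \<le> norm ((euler h ^^ n) x - x)"
    using assms by (intro norm_euler_le)
  also note Suc
  also have "norm (euler h x - x) \<le> h * norm (A x)"
    using assms by (auto simp: euler_A intro!: mult_left_mono norm_euler_le)
  finally show ?case by (simp add: algebra_simps)
qed simp

text \<open>The difference on the left is a sum of \<open>n\<close> terms
  \<open>h ((euler h ^^ j) (A x) - A x)\<close>. As \<open>A x\<close> may lie outside
  \<open>D\<close>, it is compared with \<open>z\<close> in \<open>D\<close>, to which
  \<open>euler_pow_diff_le\<close> applies.\<close>

lemma euler_pow_derivative:
  assumes "0 \<le> h" "x \<in> D" "z \<in> D" and "n * h \<le> t"
  shows "norm ((euler h ^^ n) x - x - (n * h) *\<^sub>R A x) \<le> n * h * (2 * norm (A x - z) + t * norm (A z))"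
  using assms(4)
proof (induction n)
  case (Suc n)
  let ?J = "\<lambda>n. euler h ^^ n" and ?B = "2 * norm (A x - z) + t * norm (A z)"
  have le: "n * h \<le> t" using Suc.prems assms(1) by (simp add: algebra_simps)
  have "?J (Suc n) (A x) - A x = ?J (Suc n) (A x - z) + (?J (Suc n) z - z) + (z - A x)"
    using assms(1) euler_pow_add[of h "Suc n" "A x - z" z] by simp
  then have "norm (?J (Suc n) (A x) - A x)
      \<le> norm (?J (Suc n) (A x - z)) + norm (?J (Suc n) z - z) + norm (z - A x)"
    by (metis norm_triangle_ineq norm_triangle_mono order_refl)
  also have "norm (?J (Suc n) (A x - z)) \<le> norm (A x - z)"
    using assms(1) by (rule norm_euler_pow_le)
  also have "norm (?J (Suc n) z - z) \<le> Suc n * h * norm (A z)"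
    using assms by (intro euler_pow_diff_le)
  also have "\<dots> \<le> t * norm (A z)" using Suc.prems by (intro mult_right_mono) auto
  finally have B: "norm (?J (Suc n) (A x) - A x) \<le> ?B" by (simp add: norm_minus_commute)
  have "?J (Suc n) x = ?J n (x + h *\<^sub>R euler h (A x))"
    using euler_A(3)[OF assms(1,2)] by (simp add: funpow_swap1 algebra_simps)
  also have "\<dots> = ?J n x + h *\<^sub>R ?J (Suc n) (A x)"
    using assms(1) euler_pow_scaleC[of h n "complex_of_real h"]
    by (simp add: euler_pow_add funpow_swap1 scaleC_complex_of_real)
  finally have "?J (Suc n) x - x - (Suc n * h) *\<^sub>R A x
      = (?J n x - x - (n * h) *\<^sub>R A x) + h *\<^sub>R (?J (Suc n) (A x) - A x)"
    by (simp add: algebra_simps)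
  then have "norm (?J (Suc n) x - x - (Suc n * h) *\<^sub>R A x)
      \<le> norm (?J n x - x - (n * h) *\<^sub>R A x) + h * norm (?J (Suc n) (A x) - A x)"
    using assms(1) by (metis abs_of_nonneg norm_scaleR norm_triangle_ineq)
  also have "\<dots> \<le> n * h * ?B + h * ?B"
    using Suc.IH[OF le] B assms(1) by (intro add_mono mult_left_mono) auto
  finally show ?case by (simp add: algebra_simps)
qed simp

text \<open>If \<open>y\<close> is orthogonal to \<open>D\<close> and \<open>x - A x = y\<close>,
  then pairing with \<open>x\<close> gives \<open>inner x x = inner (A x) x \<le> 0\<close>, so
  \<open>x\<close> and \<open>y\<close> vanish.\<close>

lemma dense_D: "closure D = UNIV"
proof (rule dense_if_orthogonal_trivial)
  show "subspace D" using lin by (rule clinear_on_subspace)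
  fix y assume orth: "\<And>x. x \<in> D \<Longrightarrow> inner x y = 0"
  obtain x where x: "x \<in> D" "x - A x = y" using range[of 1 y] by auto
  have "inner x y = 0" using orth x by blast
  then have "inner x x = inner (A x) x"
    using x(2) by (auto simp: inner_diff_right inner_commute)
  then have "x = 0" using dissipative[OF x(1)] by (metis inner_eq_zero_iff inner_ge_zero order_antisym)
  then show "y = 0" using x lin clinear_on_0 by fastforce
qed

text \<open>One Euler step maps \<open>D\<close> into \<open>dom_sq\<close> and moves
  \<open>z\<close> by at most \<open>h * norm (A z)\<close>.\<close>

lemma dense_dom_sq: "closure dom_sq = UNIV"
proof -
  have "x \<in> closure dom_sq" for x
  proof (unfold closure_approachable, intro allI impI)
    fix e :: real assume "e > 0"
    then obtain z where z: "z \<in> D" "norm (z - x) < e / 2"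
      using dense_approx[OF dense_D, of "e / 2" x] by auto
    define h where "h = e / (2 * (norm (A z) + 1))"
    have h: "h > 0" "h * norm (A z) < e / 2"
      using \<open>e > 0\<close> by (auto simp: h_def field_simps add_pos_nonneg add_nonneg_pos)
    let ?y = "euler h z"
    have "?y \<in> dom_sq" using z h by (simp add: dom_sq_def euler_A euler_dom)
    moreover have "norm (?y - z) \<le> h * norm (A z)"
      using z h norm_euler_le[of h "A z"] by (simp add: euler_A)
    then have "dist ?y x < e"
      using h z(2) norm_triangle_ineq[of "?y - z" "z - x"] by (simp add: dist_norm)
    ultimately show "\<exists>y\<in>dom_sq. dist y x < e" by blast
  qed
  then show ?thesis by blast
qed

section \<open>The limit semigroup and its generator\<close>

definition approx :: "nat \<Rightarrow> real \<Rightarrow> 'a \<Rightarrow> 'a"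
  where "approx n t = euler (t / 2 ^ n) ^^ (2 ^ n)"

definition sg :: "real \<Rightarrow> 'a \<Rightarrow> 'a"
  where "sg t x = lim (\<lambda>n. approx n t x)"

lemma approx_add: "0 \<le> t \<Longrightarrow> approx n t (x + y) = approx n t x + approx n t y"
  and approx_scaleC: "0 \<le> t \<Longrightarrow> approx n t (c *\<^sub>C x) = c *\<^sub>C approx n t x"
  and norm_approx_le: "0 \<le> t \<Longrightarrow> norm (approx n t x) \<le> norm x"
  by (simp_all add: approx_def euler_pow_add euler_pow_scaleC norm_euler_pow_le)

lemma linear_approx: "0 \<le> t \<Longrightarrow> linear (approx n t)"
  using approx_scaleC[of t n "complex_of_real _"]
  by (intro linearI) (auto simp: approx_add scaleC_complex_of_real)

text \<open>With powers of two as step counts, a refinement splits every step into two halves, so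
  \<open>euler_steps\<close> compares \<open>2 ^ n\<close> pairs of half steps with the full ones.
  The resulting bound is geometric in \<open>n\<close>, hence summable.\<close>

lemma approx_Suc_diff:
  assumes "0 \<le> t" "x \<in> dom_sq"
  shows "norm (approx (Suc n) t x - approx n t x) \<le> t\<^sup>2 * norm (A (A x)) * (1 / 2) ^ n"
proof -
  let ?h = "t / 2 ^ Suc n"
  have "approx (Suc n) t = (euler ?h ^^ 2) ^^ (2 ^ n)"
    by (simp add: approx_def funpow_mult)
  also have "euler ?h ^^ 2 = euler ?h \<circ> euler ?h" by (simp add: numeral_2_eq_2)
  finally have eq: "approx (Suc n) t = (euler ?h \<circ> euler ?h) ^^ (2 ^ n)" .
  have eq': "approx n t = euler (?h + ?h) ^^ (2 ^ n)" by (simp add: approx_def)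
  have "norm (approx (Suc n) t x - approx n t x) \<le> (2 ^ n :: nat) * (?h * ?h) * norm (A (A x))"
    unfolding eq eq' using assms by (intro euler_steps) auto
  also have "\<dots> = t\<^sup>2 * norm (A (A x)) * (1 / 2) ^ n / 4"
    by (simp add: field_simps power2_eq_square power_divide)
  also have "\<dots> \<le> t\<^sup>2 * norm (A (A x)) * (1 / 2) ^ n" by simp
  finally show ?thesis .
qed

lemma approx_tendsto:
  assumes "0 \<le> t"
  shows "(\<lambda>n. approx n t x) \<longlonglongrightarrow> sg t x"
proof -
  have "convergent (\<lambda>n. approx n t x)"
  proof (rule contractions_convergent[where T = "\<lambda>n. approx n t" and V = dom_sq])
    show "linear (approx n t)" "norm (approx n t x) \<le> norm x" for n x
      using assms by (auto intro: linear_approx norm_approx_le)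
    show "closure dom_sq = UNIV" by (rule dense_dom_sq)
    fix x assume x: "x \<in> dom_sq"
    have "summable (\<lambda>n. approx (Suc n) t x - approx n t x)"
    proof (rule summable_comparison_test')
      show "summable (\<lambda>n. t\<^sup>2 * norm (A (A x)) * (1 / 2) ^ n)"
        by (intro summable_mult summable_geometric) simp
    qed (rule approx_Suc_diff[OF assms x])
    then have "convergent (\<lambda>n. \<Sum>i<n. approx (Suc i) t x - approx i t x)"
      by (simp add: summable_iff_convergent)
    then have "convergent (\<lambda>n. approx n t x - approx 0 t x)"
      by (simp only: sum_lessThan_telescope[of "\<lambda>n. approx n t x"])
    from convergent_add[OF this convergent_const[of "approx 0 t x"]]
    show "convergent (\<lambda>n. approx n t x)" by simp
  qed
  then show ?thesis by (simp add: sg_def convergent_LIMSEQ_iff)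
qed

lemma norm_sg_le: "0 \<le> t \<Longrightarrow> norm (sg t x) \<le> norm x"
  by (rule LIMSEQ_le_const2[OF tendsto_norm[OF approx_tendsto]]) (auto simp: norm_approx_le)

lemma sg_add: "0 \<le> t \<Longrightarrow> sg t (x + y) = sg t x + sg t y"
  using LIMSEQ_unique[OF approx_tendsto[of t "x + y"]]
    tendsto_add[OF approx_tendsto[of t x] approx_tendsto[of t y]]
  by (simp add: approx_add)

lemma sg_scaleC:
  assumes "0 \<le> t"
  shows "sg t (c *\<^sub>C x) = c *\<^sub>C sg t x"
proof (rule LIMSEQ_unique[OF approx_tendsto[OF assms]])
  have "(\<lambda>n. norm (c *\<^sub>C (approx n t x - sg t x))) \<longlonglongrightarrow> cmod c * norm (0 :: 'a)"
    unfolding norm_scaleC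
    by (intro tendsto_intros) (use LIM_zero[OF approx_tendsto[OF assms, of x]] in simp)
  then have "(\<lambda>n. c *\<^sub>C (approx n t x - sg t x)) \<longlonglongrightarrow> 0"
    by (subst tendsto_norm_zero_iff[symmetric]) simp
  then show "(\<lambda>n. approx n t (c *\<^sub>C x)) \<longlonglongrightarrow> c *\<^sub>C sg t x"
    using assms by (simp add: approx_scaleC scaleC_diff_right LIM_zero_iff)
qed

lemma bounded_clinear_sg: "0 \<le> t \<Longrightarrow> bounded_clinear (sg t)"
  by (rule bounded_clinearI[where k = 1]) (auto simp: sg_add sg_scaleC norm_sg_le)

lemma sg_diff: "0 \<le> t \<Longrightarrow> sg t (x - y) = sg t x - sg t y"
  using bounded_clinear_sg bounded_clinear_imp_linear linear_diff bounded_linear.linear by blast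

lemma sg_0: "sg 0 x = x"
proof -
  have "approx n 0 x = x" for n
  proof -
    have "(euler 0 ^^ k) x = x" for k by (induction k) auto
    then show ?thesis by (simp add: approx_def)
  qed
  then show ?thesis by (simp add: sg_def)
qed

text \<open>On \<open>dom_sq\<close>, composing the schemes for \<open>s\<close> and
  \<open>t\<close> amounts, by commutation, to \<open>2 ^ n\<close> double steps, which
  \<open>euler_steps\<close> compares with the steps for \<open>s + t\<close>; the error factor
  \<open>2 ^ n * (s / 2 ^ n) * (t / 2 ^ n)\<close> tends to zero. Density and continuity extend the
  law to all \<open>x\<close>.\<close>

lemma sg_plus:
  assumes "0 \<le> s" "0 \<le> t"
  shows "sg (s + t) x = sg s (sg t x)"
proof -
  have on_dom_sq: "sg (s + t) x = sg s (sg t x)" if x: "x \<in> dom_sq" for x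
  proof -
    let ?c = "s * t * norm (A (A x))"
    have bound: "norm (approx n s (approx n t x) - approx n (s + t) x) \<le> ?c * (1 / 2) ^ n" for n
    proof -
      let ?a = "s / 2 ^ n" and ?b = "t / 2 ^ n"
      have pow: "((euler ?a \<circ> euler ?b) ^^ k) y = (euler ?a ^^ k) ((euler ?b ^^ k) y)" for k y
      proof (induction k arbitrary: y)
        case (Suc k)
        have comm: "euler ?b ((euler ?a ^^ j) w) = (euler ?a ^^ j) (euler ?b w)" for j w
          using assms by (induction j) (auto simp: euler_commute[of ?b ?a])
        show ?case using Suc comm by simp
      qed simp
      have "norm (approx n s (approx n t x) - approx n (s + t) x) \<le> (2 ^ n :: nat) * (?a * ?b) * norm (A (A x))"
        using euler_steps[of ?a ?b x "2 ^ n"] assms x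
        by (simp only: pow) (simp add: approx_def add_divide_distrib)
      also have "\<dots> = ?c * (1 / 2) ^ n" by (simp add: field_simps power_divide)
      finally show ?thesis .
    qed
    have "(\<lambda>n. ?c * (1 / 2) ^ n) \<longlonglongrightarrow> 0"
      by (rule tendsto_mult_right_zero[OF LIMSEQ_power_zero]) simp
    then have lim0: "(\<lambda>n. approx n s (approx n t x) - approx n (s + t) x) \<longlonglongrightarrow> 0"
      by (rule Lim_null_comparison[OF always_eventually[OF allI[OF bound]]])
    \<comment> \<open>Operator and argument both vary with \<open>n\<close>; the uniform contraction
      bound allows replacing the argument by its limit first.\<close>
    have "(\<lambda>n. approx n s (approx n t x)) \<longlonglongrightarrow> sg s (sg t x)"
    proof -
      have "(\<lambda>n. norm (approx n t x - sg t x)) \<longlonglongrightarrow> 0"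
        by (rule tendsto_norm_zero[OF LIM_zero[OF approx_tendsto[OF assms(2)]]])
      then have "(\<lambda>n. approx n s (approx n t x - sg t x)) \<longlonglongrightarrow> 0"
        by (rule Lim_null_comparison[OF always_eventually[OF allI[OF norm_approx_le[OF assms(1)]]]])
      from tendsto_add[OF this approx_tendsto[OF assms(1), of "sg t x"]]
      show ?thesis using assms by (simp flip: approx_add)
    qed
    from tendsto_diff[OF this lim0] have "(\<lambda>n. approx n (s + t) x) \<longlonglongrightarrow> sg s (sg t x)"
      by simp
    then show ?thesis
      using LIMSEQ_unique[OF approx_tendsto] assms by simp
  qed
  have cont: "continuous_on UNIV (sg t)" if "0 \<le> t" for t
    using bounded_clinear_sg[OF that] linear_continuous_on bounded_clinear_imp_linear by blast
  have "continuous_on (closure dom_sq) (\<lambda>x. sg (s + t) x - sg s (sg t x))"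
    unfolding dense_dom_sq using assms
    by (intro continuous_intros cont continuous_on_compose2[OF cont cont]) auto
  then have "sg (s + t) x - sg s (sg t x) = 0"
    by (rule continuous_constant_on_closure[where a = 0]) (auto simp: on_dom_sq dense_dom_sq)
  then show ?thesis by simp
qed

lemma sg_derivative_estimate:
  assumes "0 \<le> t" "x \<in> D" "z \<in> D"
  shows "norm (sg t x - x - t *\<^sub>R A x) \<le> t * (2 * norm (A x - z) + t * norm (A z))"
proof (rule LIMSEQ_le_const2[OF tendsto_norm])
  show "(\<lambda>n. approx n t x - x - t *\<^sub>R A x) \<longlonglongrightarrow> sg t x - x - t *\<^sub>R A x"
    by (intro tendsto_intros approx_tendsto assms)
  have "norm (approx n t x - x - t *\<^sub>R A x) \<le> t * (2 * norm (A x - z) + t * norm (A z))" for n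
    using euler_pow_derivative[of "t / 2 ^ n" x z "2 ^ n" t] assms by (simp add: approx_def)
  then show "\<exists>N. \<forall>n\<ge>N. norm (approx n t x - x - t *\<^sub>R A x) \<le> t * (2 * norm (A x - z) + t * norm (A z))"
    by blast
qed

lemma sg_diff_le:
  assumes "0 \<le> t" "x \<in> D"
  shows "norm (sg t x - x) \<le> t * norm (A x)"
proof (rule LIMSEQ_le_const2[OF tendsto_norm])
  show "(\<lambda>n. approx n t x - x) \<longlonglongrightarrow> sg t x - x"
    by (intro tendsto_intros approx_tendsto assms)
  have "norm (approx n t x - x) \<le> t * norm (A x)" for n
    using euler_pow_diff_le[of "t / 2 ^ n" x "2 ^ n"] assms by (simp add: approx_def)
  then show "\<exists>N. \<forall>n\<ge>N. norm (approx n t x - x) \<le> t * norm (A x)" by blast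
qed

lemma sg_tendsto: "((\<lambda>t. sg t x) \<longlongrightarrow> x) (at_right 0)"
proof (rule tendstoI)
  fix e :: real assume "e > 0"
  then obtain z where z: "z \<in> D" "norm (z - x) < e / 3"
    using dense_approx[OF dense_D, of "e / 3" x] by auto
  have "((\<lambda>t. t * norm (A z)) \<longlongrightarrow> 0 * norm (A z)) (at_right 0)"
    by (intro tendsto_intros)
  then have "\<forall>\<^sub>F t in at_right 0. t * norm (A z) < e / 3"
    by (rule order_tendstoD) (use \<open>e > 0\<close> in simp)
  then show "\<forall>\<^sub>F t in at_right 0. dist (sg t x) x < e"
    using eventually_at_right_less[of 0]
  proof eventually_elim
    case (elim t)
    have "sg t x - x = sg t (x - z) + (sg t z - z) + (z - x)"
      using elim by (simp add: sg_diff)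
    then have "norm (sg t x - x) \<le> norm (sg t (x - z)) + norm (sg t z - z) + norm (z - x)"
      by (metis norm_triangle_ineq norm_triangle_mono order_refl)
    then show ?case
      using elim z sg_diff_le[of t z] norm_sg_le[of t "x - z"]
      by (simp add: dist_norm norm_minus_commute)
  qed
qed

lemma sg_derivative:
  assumes "x \<in> D"
  shows "((\<lambda>t. (1 / t) *\<^sub>R (sg t x - x)) \<longlongrightarrow> A x) (at_right 0)"
proof (rule tendstoI)
  fix e :: real assume "e > 0"
  then obtain z where z: "z \<in> D" "norm (A x - z) < e / 4"
    using dense_approx[OF dense_D, of "e / 4" "A x"] by (auto simp: norm_minus_commute)
  have "((\<lambda>t. t * norm (A z)) \<longlongrightarrow> 0 * norm (A z)) (at_right 0)"
    by (intro tendsto_intros)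
  then have "\<forall>\<^sub>F t in at_right 0. t * norm (A z) < e / 2"
    by (rule order_tendstoD) (use \<open>e > 0\<close> in simp)
  then show "\<forall>\<^sub>F t in at_right 0. dist ((1 / t) *\<^sub>R (sg t x - x)) (A x) < e"
    using eventually_at_right_less[of 0]
  proof eventually_elim
    case (elim t)
    have "(1 / t) *\<^sub>R (sg t x - x) - A x = (1 / t) *\<^sub>R (sg t x - x - t *\<^sub>R A x)"
      using elim by (simp add: scaleR_diff_right)
    then have "norm ((1 / t) *\<^sub>R (sg t x - x) - A x) \<le> (1 / t) * (t * (2 * norm (A x - z) + t * norm (A z)))"
      using elim sg_derivative_estimate[of t x z] assms z
      by (simp only: norm_scaleR abs_divide) (intro mult_mono, auto)
    also have "\<dots> = 2 * norm (A x - z) + t * norm (A z)" using elim by simp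
    also have "\<dots> < e" using elim z by simp
    finally show ?case by (simp add: dist_norm)
  qed
qed

text \<open>For the converse direction, \<open>u\<close> is chosen with
  \<open>u - A u = x - y\<close>. The difference quotient at \<open>?w = x - u\<close> then tends to
  \<open>?w\<close> itself, while contractivity keeps its inner product with \<open>?w\<close>
  nonpositive; hence \<open>?w = 0\<close>.\<close>

lemma generator_sg: "is_generator sg D A"
  unfolding is_generator_def
proof (intro allI iffI)
  fix x y
  assume "x \<in> D \<and> A x = y"
  then show "((\<lambda>t. (1 / t) *\<^sub>R (sg t x - x)) \<longlongrightarrow> y) (at_right 0)"
    using sg_derivative by blast
next
  fix x y
  assume lim: "((\<lambda>t. (1 / t) *\<^sub>R (sg t x - x)) \<longlongrightarrow> y) (at_right 0)"
  obtain u where u: "u \<in> D" "u - A u = x - y" using range[of 1 "x - y"] by auto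
  let ?w = "x - u"
  have "((\<lambda>t. (1 / t) *\<^sub>R (sg t x - x) - (1 / t) *\<^sub>R (sg t u - u)) \<longlongrightarrow> y - A u) (at_right 0)"
    by (intro tendsto_diff lim sg_derivative u)
  also have "y - A u = ?w" using u(2) by (simp add: algebra_simps)
  finally have "((\<lambda>t. inner ((1 / t) *\<^sub>R (sg t x - x) - (1 / t) *\<^sub>R (sg t u - u)) ?w) \<longlongrightarrow> inner ?w ?w) (at_right 0)"
    by (intro tendsto_inner tendsto_const)
  moreover have "\<forall>\<^sub>F t in at_right 0.
      inner ((1 / t) *\<^sub>R (sg t x - x) - (1 / t) *\<^sub>R (sg t u - u)) ?w \<le> 0"
    using eventually_at_right_less[of 0]
  proof eventually_elim
    case (elim t)
    have "inner (sg t ?w) ?w \<le> norm (sg t ?w) * norm ?w" by (rule norm_cauchy_schwarz)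
    also have "\<dots> \<le> norm ?w * norm ?w"
      using elim by (intro mult_right_mono norm_sg_le) auto
    finally have "inner (sg t ?w - ?w) ?w \<le> 0"
      by (simp add: inner_diff_left flip: power2_norm_eq_inner power2_eq_square)
    moreover have "(1 / t) *\<^sub>R (sg t x - x) - (1 / t) *\<^sub>R (sg t u - u) = (1 / t) *\<^sub>R (sg t ?w - ?w)"
      using elim by (simp add: sg_diff algebra_simps)
    ultimately show ?case using elim by (simp add: divide_nonpos_pos)
  qed
  ultimately have "inner ?w ?w \<le> 0"
    by (rule tendsto_upperbound) simp
  then have "x = u" by (metis eq_iff_diff_eq_0 inner_eq_zero_iff inner_ge_zero order_antisym)
  then show "x \<in> D \<and> A x = y" using u by auto
qed

lemma generates_contraction_semigroup: "generates_contraction_semigroup D A"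
  unfolding generates_contraction_semigroup_def
proof (intro exI[of _ sg] conjI allI impI)
  show "C0_semigroup sg"
    unfolding C0_semigroup_def fun_eq_iff comp_def id_def
    using bounded_clinear_sg sg_0 sg_plus sg_tendsto by blast
  show "is_generator sg D A" by (rule generator_sg)
  show "onorm (sg t) \<le> 1" if "0 \<le> t" for t
    using norm_sg_le[OF that] by (intro onorm_bound) simp_all
qed

end

section \<open>Surjectivity for semigroup generators\<close>

text \<open>Translates derivatives relative to an interval, as the fundamental theorem of calculus
  supplies them, into the right limits in which \<open>is_generator\<close> is stated.\<close>

lemma right_difference_quotient:
  fixes f :: "real \<Rightarrow> 'a::real_normed_vector"
  assumes "(f has_vector_derivative d) (at a within {c..b})" "c \<le> a" "a < b"
  shows "((\<lambda>h. (1 / h) *\<^sub>R (f (a + h) - f a)) \<longlongrightarrow> d) (at_right 0)"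
proof (rule tendstoI)
  fix e :: real assume "e > 0"
  then obtain k where k: "k > 0"
    "\<And>y. y \<in> {c..b} \<Longrightarrow> norm (y - a) < k \<Longrightarrow> norm (f y - f a - (y - a) *\<^sub>R d) \<le> e / 2 * norm (y - a)"
    using assms(1) unfolding has_vector_derivative_def has_derivative_within_alt
    by (metis half_gt_zero)
  have "\<forall>\<^sub>F h in at_right 0. h < min k (b - a)"
    using k(1) assms(3) by (intro order_tendstoD(2)[OF tendsto_ident_at]) auto
  then show "\<forall>\<^sub>F h in at_right 0. dist ((1 / h) *\<^sub>R (f (a + h) - f a)) d < e"
    using eventually_at_right_less[of 0]
  proof eventually_elim
    case (elim h)
    have "norm (f (a + h) - f a - h *\<^sub>R d) \<le> e / 2 * h"
      using k(2)[of "a + h"] elim assms(2) by simp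
    moreover have "(1 / h) *\<^sub>R (f (a + h) - f a) - d = (1 / h) *\<^sub>R (f (a + h) - f a - h *\<^sub>R d)"
      using elim by (simp add: scaleR_diff_right)
    ultimately have "norm ((1 / h) *\<^sub>R (f (a + h) - f a) - d) \<le> (1 / h) * (e / 2 * h)"
      using elim by (simp only: norm_scaleR) (intro mult_mono, auto)
    then have "norm ((1 / h) *\<^sub>R (f (a + h) - f a) - d) \<le> e / 2"
      using elim by simp
    then show ?case using \<open>e > 0\<close> by (simp add: dist_norm)
  qed
qed

text \<open>By Baire's theorem one of the closed sets \<open>F n\<close>, which cover the space, has
  interior points. A ball inside it bounds \<open>S t\<close> for all small positive
  \<open>t\<close> by homogeneity.\<close>

lemma C0_semigroup_locally_bounded:
  fixes S :: "real \<Rightarrow> 'a::chilbert_space \<Rightarrow> 'a"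
  assumes S: "C0_semigroup S"
  obtains \<delta> M where "0 < \<delta>" "\<And>t x. 0 \<le> t \<Longrightarrow> t \<le> \<delta> \<Longrightarrow> norm (S t x) \<le> M * norm x"
proof -
  have bl: "bounded_linear (S t)" if "0 \<le> t" for t
    using S that by (simp add: C0_semigroup_def bounded_clinear_def)
  have S0: "S 0 x = x" for x using S by (simp add: C0_semigroup_def)
  have lim: "((\<lambda>t. S t x) \<longlongrightarrow> x) (at_right 0)" for x using S by (simp add: C0_semigroup_def)
  \<comment> \<open>One index controls both the time span and the bound. With \<open>n\<close> in
    place of \<open>Suc n\<close> the span for \<open>n = 0\<close> would be empty and
    \<open>F 0\<close> the whole space.\<close>
  define F where "F n = {x. \<forall>t\<in>{0<..1 / real (Suc n)}. norm (S t x) \<le> real n}" for n :: nat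
  have closedF: "closed (F n)" for n
  proof -
    have "F n = (\<Inter>t\<in>{0<..1 / real (Suc n)}. {x. norm (S t x) \<le> real n})" by (auto simp: F_def)
    moreover have "closed {x. norm (S t x) \<le> real n}" if "t > 0" for t
      using that
      by (intro closed_Collect_le continuous_intros linear_continuous_on bl) auto
    ultimately show ?thesis by auto
  qed
  have cover: "\<exists>n. x \<in> F n" for x
  proof -
    have "\<forall>\<^sub>F t in at_right 0. dist (S t x) x < 1"
      using lim by (rule tendstoD) simp
    then obtain b where b: "b > 0" "\<And>t. 0 < t \<Longrightarrow> t < b \<Longrightarrow> dist (S t x) x < 1"
      by (auto simp: eventually_at_right_field)
    obtain n :: nat where n: "n > max (1 / b) (norm x + 1)"
      using reals_Archimedean2 by blast
    have "1 / real (Suc n) < b"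
      using n b(1) by (simp add: field_simps)
    then have "norm (S t x) \<le> n" if "t \<in> {0<..1 / real (Suc n)}" for t
      using b(2)[of t] that n norm_triangle_sub[of "S t x" x] by (auto simp: dist_norm)
    then show ?thesis unfolding F_def by blast
  qed
  have "\<exists>n. interior (F n) \<noteq> {}"
  proof (rule ccontr)
    assume "\<nexists>n. interior (F n) \<noteq> {}"
    then have "euclidean interior_of \<Union> (range F) = ({} :: 'a set)"
      using closedF
      by (intro Baire_category_alt) (auto simp: completely_metrizable_space_euclidean)
    moreover have "\<Union> (range F) = UNIV" using cover by blast
    ultimately show False by simp
  qed
  then obtain n x0 where "x0 \<in> interior (F n)" by blast
  then obtain e where e: "e > 0" "cball x0 e \<subseteq> F n"
    by (meson mem_interior_cball)
  have bound: "norm (S t x) \<le> 2 * n / e * norm x" if t: "0 < t" "t \<le> 1 / real (Suc n)" for t x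
  proof (cases "x = 0")
    case True
    then show ?thesis using bl[of t] t linear_0 bounded_linear.linear by fastforce
  next
    case False
    let ?y = "(e / norm x) *\<^sub>R x"
    interpret bounded_linear "S t" using bl t by simp
    have "x0 + ?y \<in> F n" "x0 \<in> F n"
      using e False by (auto simp: dist_norm)
    then have "norm (S t (x0 + ?y)) \<le> n" "norm (S t x0) \<le> n"
      using t by (auto simp: F_def)
    moreover have "norm (S t ?y) \<le> norm (S t (x0 + ?y)) + norm (S t x0)"
      using norm_triangle_ineq4[of "S t (x0 + ?y)" "S t x0"] by (simp add: add)
    ultimately have "norm (S t ?y) \<le> n + n" by linarith
    then show ?thesis using e(1) False by (simp add: scaleR field_simps)
  qed
  show thesis
  \<comment> \<open>The maximum with \<open>1\<close> takes care of \<open>t = 0\<close>, where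
    \<open>S t\<close> is the identity.\<close>
  proof (rule that[of "1 / real (Suc n)" "max 1 (2 * n / e)"])
    fix t x assume t: "0 \<le> t" "t \<le> 1 / real (Suc n)"
    show "norm (S t x) \<le> max 1 (2 * n / e) * norm x"
    proof (cases "t = 0")
      case True
      then show ?thesis using mult_right_mono[of 1 "max 1 (2 * n / e)" "norm x"] by (simp add: S0)
    next
      case False
      then have "norm (S t x) \<le> 2 * n / e * norm x" using bound t by simp
      also have "\<dots> \<le> max 1 (2 * n / e) * norm x" by (intro mult_right_mono) auto
      finally show ?thesis .
    qed
  qed simp
qed

text \<open>Uses a Laplace transform cut off at time \<open>T\<close>: its value \<open>G T\<close>
  satisfies \<open>(l - A) (G T) = x - exp (- l * T) *\<^sub>R S T x\<close>. For the chosen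
  \<open>l\<close> the right side perturbs the identity by a map of norm at most
  \<open>1 / 2\<close>, so it covers the whole space.\<close>

lemma generator_shift_surj:
  fixes S :: "real \<Rightarrow> 'a::chilbert_space \<Rightarrow> 'a"
  assumes S: "C0_semigroup S" and gen: "is_generator S D A"
  obtains l where "0 < l" "\<And>y. \<exists>x\<in>D. l *\<^sub>R x - A x = y"
proof -
  obtain \<delta> M where \<delta>: "0 < \<delta>" and M: "\<And>t x. 0 \<le> t \<Longrightarrow> t \<le> \<delta> \<Longrightarrow> norm (S t x) \<le> M * norm x"
    using C0_semigroup_locally_bounded[OF S] by blast
  have bl: "bounded_linear (S t)" if "0 \<le> t" for t
    using S that by (simp add: C0_semigroup_def bounded_clinear_def)
  have S0: "S 0 x = x" for x using S by (simp add: C0_semigroup_def)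
  have plus: "S (s + t) x = S s (S t x)" if "0 \<le> s" "0 \<le> t" for s t x
    using S that by (simp add: C0_semigroup_def)
  have lim: "((\<lambda>t. S t x) \<longlongrightarrow> x) (at_right 0)" for x using S by (simp add: C0_semigroup_def)
  \<comment> \<open>Half of \<open>\<delta>\<close>, so that the times \<open>T + h\<close> with
    \<open>h \<le> T\<close> stay where the local bound holds.\<close>
  define T where "T = \<delta> / 2"
  have T: "0 < T" "T < \<delta>" "T + T = \<delta>" using \<delta> by (auto simp: T_def)
  define M' where "M' = max 1 M"
  have M': "norm (S t x) \<le> M' * norm x" if "0 \<le> t" "t \<le> \<delta>" for t x
    using M[OF that, of x] by (rule order_trans) (intro mult_right_mono, auto simp: M'_def)
  have M'1: "M' \<ge> 1" by (simp add: M'_def)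
  \<comment> \<open>Chosen so that \<open>exp (- l * T) * M'\<close> equals
    \<open>1 / 2\<close>.\<close>
  define l where "l = ln (2 * M') / T"
  have l: "0 < l" "exp (- l * T) * M' = 1 / 2"
    using M'1 T by (simp_all add: l_def exp_minus field_simps)
  have cont: "continuous_on {0..\<delta>} (\<lambda>t. S t x)" for x
  proof (unfold continuous_on_iff, intro ballI allI impI)
    fix t e assume t: "t \<in> {0..\<delta>}" and e: "(e :: real) > 0"
    have "\<forall>\<^sub>F h in at_right 0. dist (S h x) x < e / M'"
      using e M'1 by (intro tendstoD[OF lim]) auto
    then obtain b where b: "b > 0" "\<And>h. 0 < h \<Longrightarrow> h < b \<Longrightarrow> dist (S h x) x < e / M'"
      by (auto simp: eventually_at_right_field)
    \<comment> \<open>Factoring out \<open>S q\<close> at the smaller time reduces continuity from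
      both sides to right continuity at zero.\<close>
    have le: "dist (S p x) (S q x) < e" if "0 \<le> q" "q < p" "p \<le> \<delta>" "p - q < b" for p q
    proof -
      have "S p x - S q x = S q (S (p - q) x - x)"
        using plus[of q "p - q" x] that bl[of q]
        by (simp add: linear_diff bounded_linear.linear)
      then have "norm (S p x - S q x) \<le> M' * norm (S (p - q) x - x)"
        using M'[of q] that by simp
      also have "\<dots> < M' * (e / M')"
        using b(2)[of "p - q"] that M'1 by (intro mult_strict_left_mono) (auto simp: dist_norm)
      finally show ?thesis using M'1 by (simp add: dist_norm)
    qed
    show "\<exists>d>0. \<forall>t'\<in>{0..\<delta>}. dist t' t < d \<longrightarrow> dist (S t' x) (S t x) < e"
    proof (intro exI conjI ballI impI)
      fix t' assume t': "t' \<in> {0..\<delta>}" "dist t' t < b"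
      show "dist (S t' x) (S t x) < e"
        using le[of t t'] le[of t' t] t t' e
        by (cases t t' rule: linorder_cases) (auto simp: dist_real_def dist_commute)
    qed (rule b)
  qed
  have key: "\<exists>y\<in>D. l *\<^sub>R y - A y = x - exp (- l * T) *\<^sub>R S T x" for x
  proof -
    define g where "g s = exp (- l * s) *\<^sub>R S s x" for s
    define G where "G s = integral {0..s} g" for s
    have cg: "continuous_on {0..\<delta>} g"
      unfolding g_def by (intro continuous_intros cont)
    have ig: "g integrable_on {a..b}" if "0 \<le> a" "b \<le> \<delta>" for a b
      by (intro integrable_continuous_real continuous_on_subset[OF cg]) (use that in auto)
    have quot: "((\<lambda>h. (1 / h) *\<^sub>R (G (a + h) - G a)) \<longlongrightarrow> g a) (at_right 0)" if "0 \<le> a" "a < \<delta>" for a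
      unfolding G_def
      by (rule right_difference_quotient[OF integral_has_vector_derivative[OF cg]]) (use that in auto)
    \<comment> \<open>The semigroup law shifts the window of integration from \<open>{0..T}\<close>
      to \<open>{h..T + h}\<close>.\<close>
    have SG: "S h (G T) = exp (l * h) *\<^sub>R (G (T + h) - G h)" if h: "0 \<le> h" "h \<le> T" for h
    proof -
      have "S h (G T) = integral {0..T} (S h \<circ> g)"
        unfolding G_def using ig[of 0 T] T h by (intro integral_linear[symmetric] bl) auto
      also have "\<dots> = integral {0..T} (\<lambda>t. exp (l * h) *\<^sub>R (g \<circ> (+) h) t)"
      proof (rule integral_cong)
        fix t assume "t \<in> {0..T}"
        then have "S h (S t x) = S (h + t) x" using plus h by simp
        then show "(S h \<circ> g) t = exp (l * h) *\<^sub>R (g \<circ> (+) h) t"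
          using bl[OF h(1)]
          by (simp add: g_def linear_cmul bounded_linear.linear algebra_simps flip: exp_add)
      qed
      also have "\<dots> = exp (l * h) *\<^sub>R integral {0 + h..T + h} g"
        by (simp only: integral_cmul integral_shift_Icc_real)
      also have "integral {0 + h..T + h} g = G (T + h) - G h"
        using Henstock_Kurzweil_Integration.integral_combine[of 0 h "T + h" g] ig[of 0 "T + h"] T h
        by (simp add: G_def algebra_simps)
      finally show ?thesis .
    qed
    have exp_quot: "((\<lambda>h. (exp (l * h) - 1) / h) \<longlongrightarrow> l) (at_right 0)"
    proof -
      have "((\<lambda>h. exp (l * h)) has_vector_derivative l) (at 0 within {0..1})"
        unfolding has_real_derivative_iff_has_vector_derivative[symmetric]
        by (auto intro!: derivative_eq_intros)
      from right_difference_quotient[OF this] show ?thesis by simp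
    qed
    \<comment> \<open>The difference quotient of \<open>S h (G T)\<close>, arranged as by the
      product rule so that every factor has a known limit.\<close>
    have "((\<lambda>h. exp (l * h) *\<^sub>R ((1 / h) *\<^sub>R (G (T + h) - G T) - (1 / h) *\<^sub>R (G (0 + h) - G 0))
        + ((exp (l * h) - 1) / h) *\<^sub>R G T) \<longlongrightarrow> exp (l * 0) *\<^sub>R (g T - g 0) + l *\<^sub>R G T) (at_right 0)"
      using T \<delta> by (intro tendsto_intros quot exp_quot) auto
    moreover have "\<forall>\<^sub>F h in at_right 0.
        exp (l * h) *\<^sub>R ((1 / h) *\<^sub>R (G (T + h) - G T) - (1 / h) *\<^sub>R (G (0 + h) - G 0))
          + ((exp (l * h) - 1) / h) *\<^sub>R G T = (1 / h) *\<^sub>R (S h (G T) - G T)"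
    proof -
      have "\<forall>\<^sub>F h in at_right 0. h < T"
        using T by (intro order_tendstoD(2)[OF tendsto_ident_at]) auto
      then show ?thesis
        using eventually_at_right_less[of 0]
      proof eventually_elim
        case (elim h)
        have "G 0 = 0" by (simp add: G_def)
        moreover have "S h (G T) = exp (l * h) *\<^sub>R (G (T + h) - G h)"
          using elim by (intro SG) auto
        ultimately show ?case
          by (simp only: add_0 diff_zero) (simp add: algebra_simps divide_inverse)
      qed
    qed
    ultimately have "((\<lambda>h. (1 / h) *\<^sub>R (S h (G T) - G T)) \<longlongrightarrow> exp (l * 0) *\<^sub>R (g T - g 0) + l *\<^sub>R G T) (at_right 0)"
      by (rule Lim_transform_eventually)
    then have "((\<lambda>h. (1 / h) *\<^sub>R (S h (G T) - G T)) \<longlongrightarrow> g T - x + l *\<^sub>R G T) (at_right 0)"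
      by (simp add: g_def S0)
    then have "G T \<in> D \<and> A (G T) = g T - x + l *\<^sub>R G T"
      using gen by (simp add: is_generator_def)
    then show ?thesis by (intro bexI[of _ "G T"]) (auto simp: g_def)
  qed
  have "\<exists>x. x + (- (exp (- l * T) *\<^sub>R S T x)) = y" for y
  proof (rule perturb_surj[of "\<lambda>x. x" 1 _ "1 / 2"])
    fix x z
    have "- (exp (- l * T) *\<^sub>R S T x) - - (exp (- l * T) *\<^sub>R S T z) = exp (- l * T) *\<^sub>R S T (z - x)"
      using linear_diff[OF bounded_linear.linear[OF bl[of T]], of z x] T
      by (simp add: scaleR_diff_right)
    then have "norm (- (exp (- l * T) *\<^sub>R S T x) - - (exp (- l * T) *\<^sub>R S T z))
        = exp (- l * T) * norm (S T (z - x))" by simp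
    also have "\<dots> \<le> exp (- l * T) * (M' * norm (z - x))"
      using T M' by (intro mult_left_mono) auto
    also have "\<dots> = 1 / 2 * norm (x - z)"
      using l(2) norm_minus_commute[of x z] by (metis mult.assoc)
    finally show "norm (- (exp (- l * T) *\<^sub>R S T x) - - (exp (- l * T) *\<^sub>R S T z)) \<le> 1 / 2 * norm (x - z)" .
  qed (auto intro: linearI)
  then have "\<exists>x\<in>D. l *\<^sub>R x - A x = y" for y
    using key by (metis add_uminus_conv_diff)
  with l(1) show thesis using that by blast
qed

section \<open>Resolvents\<close>

lemma resolvent:
  assumes "\<mu> \<in> resolvent_set D A"
  shows resolvent_mem: "resolvent D A \<mu> y \<in> D"
    and resolvent_eq: "\<mu> *\<^sub>C resolvent D A \<mu> y - A (resolvent D A \<mu> y) = y"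
    and resolvent_shift: "x \<in> D \<Longrightarrow> resolvent D A \<mu> (\<mu> *\<^sub>C x - A x) = x"
    and resolvent_bounded_clinear: "bounded_clinear (resolvent D A \<mu>)"
proof -
  have bij: "bij_betw (\<lambda>x. \<mu> *\<^sub>C x - A x) D UNIV" using assms by (simp add: resolvent_set_def)
  have ex: "\<exists>!x. x \<in> D \<and> \<mu> *\<^sub>C x - A x = y" for y
    using bij unfolding bij_betw_def inj_on_def by (metis (no_types, lifting) UNIV_I imageE)
  show "resolvent D A \<mu> y \<in> D" "\<mu> *\<^sub>C resolvent D A \<mu> y - A (resolvent D A \<mu> y) = y"
    using theI'[OF ex[of y]] by (auto simp: resolvent_def)
  show "resolvent D A \<mu> (\<mu> *\<^sub>C x - A x) = x" if "x \<in> D"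
    unfolding resolvent_def by (rule the1_equality[OF ex]) (use that in simp)
  show "bounded_clinear (resolvent D A \<mu>)" using assms by (simp add: resolvent_set_def)
qed

text \<open>The lower bound yields injectivity and the norm estimate of the inverse at once, so each
  application reduces to an a priori estimate and solvability.\<close>

lemma resolvent_setI:
  assumes lin: "clinear_on D A"
    and bound: "\<And>x. x \<in> D \<Longrightarrow> norm x \<le> c * norm (\<mu> *\<^sub>C x - A x)"
    and surj: "\<And>y. \<exists>x\<in>D. \<mu> *\<^sub>C x - A x = y"
  shows "\<mu> \<in> resolvent_set D A"
    and "norm (resolvent D A \<mu> y) \<le> c * norm y"
proof -
  let ?F = "\<lambda>x. \<mu> *\<^sub>C x - A x"
  have inj: "x = z" if "x \<in> D" "z \<in> D" "?F x = ?F z" for x z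
  proof -
    have d: "x - z \<in> D" "A (x - z) = A x - A z" using clinear_on_diff[OF lin] that by auto
    then have "?F (x - z) = ?F x - ?F z" by (simp add: scaleC_diff_right)
    then show ?thesis using bound[OF d(1)] that(3) by simp
  qed
  have R: "resolvent D A \<mu> (?F x) = x" if "x \<in> D" for x
    unfolding resolvent_def by (rule the_equality) (use that inj in auto)
  show norm: "norm (resolvent D A \<mu> y) \<le> c * norm y" for y
    using surj[of y] R bound by auto
  have "bounded_clinear (resolvent D A \<mu>)"
  proof (rule bounded_clinearI[OF _ _ norm])
    fix y z a
    obtain x w where x: "x \<in> D" "?F x = y" and w: "w \<in> D" "?F w = z"
      using surj by meson
    have "?F (x + w) = y + z" "x + w \<in> D"
      using clinear_on_add[OF lin x(1) w(1)] x(2) w(2) by (auto simp: scaleC_add_right)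
    then show "resolvent D A \<mu> (y + z) = resolvent D A \<mu> y + resolvent D A \<mu> z"
      using R x w by metis
    have "?F (a *\<^sub>C x) = a *\<^sub>C y" "a *\<^sub>C x \<in> D"
      using clinear_on_scaleC[OF lin x(1)] x(2)
      by (auto simp: scaleC_diff_right scaleC_scaleC mult.commute)
    then show "resolvent D A \<mu> (a *\<^sub>C y) = a *\<^sub>C resolvent D A \<mu> y"
      using R x by metis
  qed
  moreover have "bij_betw ?F D UNIV"
    unfolding bij_betw_def
  proof
    show "inj_on ?F D" using inj by (rule inj_onI)
    show "?F ` D = UNIV"
    proof (rule UNIV_eq_I[symmetric])
      fix y
      obtain x where "x \<in> D" "?F x = y" using surj by meson
      then show "y \<in> ?F ` D" by (intro image_eqI) auto
    qed
  qed
  ultimately show "\<mu> \<in> resolvent_set D A" by (simp add: resolvent_set_def)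
qed

lemma dissipative_shift_bound:
  fixes x :: "'a::complex_inner"
  assumes "inner (A x) x \<le> 0"
  shows "Re \<mu> * norm x \<le> norm (\<mu> *\<^sub>C x - A x)"
proof (cases "x = 0")
  case False
  have "Re \<mu> * norm x * norm x \<le> inner (\<mu> *\<^sub>C x - A x) x"
    using assms by (simp add: inner_diff_left inner_scaleC_self power2_eq_square)
  also have "\<dots> \<le> norm (\<mu> *\<^sub>C x - A x) * norm x" by (rule norm_cauchy_schwarz)
  finally show ?thesis using False by simp
qed simp

text \<open>
  The method of continuity is applied along the segment from \<open>\<mu>\<close> to a positive real number; since
  \<open>\<mu>\<close> may lie on the imaginary axis, dissipativity controls only the interior of the segment.
\<close>

lemma m_dissipativeI:
  assumes lin: "clinear_on D A" and diss: "\<And>x. x \<in> D \<Longrightarrow> inner (A x) x \<le> 0"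
    and \<mu>: "\<mu> \<in> resolvent_set D A" "0 \<le> Re \<mu>"
  shows "m_dissipative D A"
proof
  fix h :: real and y assume h: "0 < h"
  define l where "l = 1 / h"
  have l: "l > 0" using h by (simp add: l_def)
  let ?R = "resolvent D A \<mu>"
  \<comment> \<open>With \<open>x = ?R v\<close>, the equation
    \<open>v + ?B v = l *\<^sub>R y\<close> reads
    \<open>l *\<^sub>R x - A x = l *\<^sub>R y\<close>, the range condition multiplied by
    \<open>l\<close>.\<close>
  let ?B = "\<lambda>y. (complex_of_real l - \<mu>) *\<^sub>C ?R y"
  have "bounded_clinear (\<lambda>y :: 'a. (complex_of_real l - \<mu>) *\<^sub>C y)"
    by (rule bounded_clinearI[where k = "cmod (complex_of_real l - \<mu>)"])
      (auto simp: scaleC_add_right scaleC_scaleC mult.commute)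
  then have B: "bounded_linear ?B"
    using bounded_clinear_compose resolvent_bounded_clinear[OF \<mu>(1)] bounded_clinear_imp_linear
    by blast
  have "\<exists>v. v + ?B v = l *\<^sub>R y"
  proof (rule continuity_method[OF B])
    fix t v assume t: "0 < t" "t \<le> (1 :: real)"
    let ?x = "?R v" and ?m = "\<mu> + complex_of_real t * (complex_of_real l - \<mu>)"
    define f where "f = v + t *\<^sub>R ?B v"
    have x: "?x \<in> D" "v = \<mu> *\<^sub>C ?x - A ?x"
      using resolvent_mem[OF \<mu>(1)] resolvent_eq[OF \<mu>(1)] by auto
    have tB: "t *\<^sub>R ?B v = (complex_of_real t * (complex_of_real l - \<mu>)) *\<^sub>C ?x"
      by (simp add: scaleC_scaleC flip: scaleC_complex_of_real)
    have f: "f = ?m *\<^sub>C ?x - A ?x"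
      unfolding f_def tB by (subst x(2)) (simp add: scaleC_add_left)
    \<comment> \<open>Here \<open>Re ?m\<close> is
      \<open>(1 - t) * Re \<mu> + t * l\<close>.\<close>
    have "t * l \<le> Re ?m" using t \<mu>(2) by (simp add: algebra_simps mult_left_le_one_le)
    then have "t * l * norm ?x \<le> Re ?m * norm ?x" by (intro mult_right_mono) auto
    also have "\<dots> \<le> norm f" unfolding f using diss[OF x(1)] by (rule dissipative_shift_bound)
    finally have tx: "t * norm ?x \<le> norm f / l" using l by (simp add: field_simps)
    have "norm v \<le> norm f + norm (t *\<^sub>R ?B v)"
      unfolding f_def using norm_triangle_ineq4[of "v + t *\<^sub>R ?B v" "t *\<^sub>R ?B v"] by simp
    also have "norm (t *\<^sub>R ?B v) = cmod (complex_of_real l - \<mu>) * (t * norm ?x)"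
      using t by simp
    also have "\<dots> \<le> cmod (complex_of_real l - \<mu>) * (norm f / l)"
      by (intro mult_left_mono tx) auto
    finally have "norm v \<le> (1 + cmod (complex_of_real l - \<mu>) / l) * norm f"
      by (simp add: distrib_right)
    moreover have "t * norm v \<le> norm v" using t by (simp add: mult_left_le_one_le)
    ultimately show "t * norm v \<le> (1 + cmod (complex_of_real l - \<mu>) / l) * norm (v + t *\<^sub>R ?B v)"
      by (simp add: f_def)
  qed
  then obtain v where v: "v + ?B v = l *\<^sub>R y" ..
  define x where "x = ?R v"
  have x: "x \<in> D" "v = \<mu> *\<^sub>C x - A x"
    using resolvent_mem[OF \<mu>(1)] resolvent_eq[OF \<mu>(1)] by (auto simp: x_def)
  have "l *\<^sub>R x - A x = v + (complex_of_real l - \<mu>) *\<^sub>C x"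
    unfolding x(2) by (simp add: scaleC_diff_left scaleC_complex_of_real)
  also have "\<dots> = l *\<^sub>R y" using v by (simp add: x_def)
  finally have "h *\<^sub>R (l *\<^sub>R x - A x) = h *\<^sub>R (l *\<^sub>R y)" by simp
  then have "x - h *\<^sub>R A x = y" using h by (simp add: l_def scaleR_diff_right)
  then show "\<exists>x\<in>D. x - h *\<^sub>R A x = y" using x(1) by blast
qed (fact lin, fact diss)

section \<open>Boundary nodes\<close>

lemma clinear_on_ker_on:
  assumes "clinear_on D L" "clinear_on D G"
  shows "clinear_on (ker_on D G) L"
  using assms unfolding clinear_on_def ker_on_def
  by (auto simp: clinear_on_0[OF assms(2)])

section \<open>Graph norms and transfer functions\<close>

lemma norm_le_graph_norm: "norm x \<le> graph_norm L x" "norm (L x) \<le> graph_norm L x"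
  unfolding graph_norm_def by (auto intro: real_le_rsqrt)

lemma graph_norm_le: "graph_norm L x \<le> norm x + norm (L x)"
  unfolding graph_norm_def by (intro real_le_lsqrt) (auto simp: power2_sum)

text \<open>\<open>W\<close> is a right inverse of \<open>G\<close>, bounded in the graph norm.
  Subtracting from \<open>W u\<close> the element of the kernel of \<open>G\<close> that removes the
  defect \<open>\<mu> *\<^sub>C W u - L (W u)\<close> produces the solution \<open>h u\<close>; its
  uniqueness makes the transfer function linear.\<close>

lemma transfer_H:
  assumes lin: "clinear_on D L" "clinear_on D G"
    and \<mu>: "\<mu> \<in> resolvent_set (ker_on D G) L"
    and W: "\<And>u. W u \<in> D" "\<And>u. G (W u) = u"
      "\<And>u. norm (W u) \<le> c * norm u" "\<And>u. norm (L (W u)) \<le> c * norm u"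
  shows transfer_H_mem: "transfer_H D G L \<mu> u \<in> D"
    and transfer_H_eq: "L (transfer_H D G L \<mu> u) = \<mu> *\<^sub>C transfer_H D G L \<mu> u"
    and transfer_H_input: "G (transfer_H D G L \<mu> u) = u"
    and transfer_H_bounded_clinear: "bounded_clinear (transfer_H D G L \<mu>)"
    and transfer_H_decomp:
      "x \<in> D \<Longrightarrow> x = resolvent (ker_on D G) L \<mu> (\<mu> *\<^sub>C x - L x) + transfer_H D G L \<mu> (G x)"
proof -
  let ?D0 = "ker_on D G" and ?R = "resolvent (ker_on D G) L \<mu>" and ?H = "transfer_H D G L \<mu>"
  note R = resolvent[OF \<mu>]
  have D0: "x \<in> D" "G x = 0" if "x \<in> ?D0" for x using that by (auto simp: ker_on_def)
  define h where "h u = W u - ?R (\<mu> *\<^sub>C W u - L (W u))" for u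
  have hD: "h u \<in> D" and Lh: "L (h u) = L (W u) - L (?R (\<mu> *\<^sub>C W u - L (W u)))"
    and Gh: "G (h u) = u" for u
    using clinear_on_diff[OF lin(1) W(1) D0(1)[OF R(1)]]
      clinear_on_diff[OF lin(2) W(1) D0(1)[OF R(1)]] D0(2)[OF R(1)] W(2)
    by (simp_all add: h_def)
  have Lh: "L (h u) = \<mu> *\<^sub>C h u" for u
    using R(2)[of "\<mu> *\<^sub>C W u - L (W u)"] unfolding Lh
    by (simp add: h_def scaleC_diff_right algebra_simps)
  have uniq: "x = z" if "x \<in> D" "z \<in> D" "L x = \<mu> *\<^sub>C x" "L z = \<mu> *\<^sub>C z" "G x = G z" for x z
  proof -
    have "x - z \<in> ?D0" "L (x - z) = L x - L z"
      using clinear_on_diff[OF lin(1) that(1,2)] clinear_on_diff[OF lin(2) that(1,2)] that(5)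
      by (auto simp: ker_on_def)
    then have "?R 0 = x - z"
      using R(3)[of "x - z"] that(3,4) by (simp add: scaleC_diff_right)
    moreover have "?R 0 = 0"
      by (rule linear_0[OF bounded_linear.linear[OF bounded_clinear_imp_linear[OF R(4)]]])
    ultimately show ?thesis by simp
  qed
  have H: "?H u = h u" for u
    unfolding transfer_H_def
  proof (rule the_equality)
    fix x assume "x \<in> D \<and> \<mu> *\<^sub>C x - L x = 0 \<and> G x = u"
    then show "x = h u" by (subst uniq[of x "h u"]) (auto simp: hD Lh Gh)
  qed (simp add: hD Lh Gh)
  show "?H u \<in> D" "L (?H u) = \<mu> *\<^sub>C ?H u" "G (?H u) = u"
    by (simp_all add: H hD Lh Gh)
  obtain k where k: "k > 0" "\<And>y. norm (?R y) \<le> norm y * k"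
    using bounded_linear.pos_bounded[OF bounded_clinear_imp_linear[OF R(4)]] by blast
  show "bounded_clinear ?H"
  proof (rule bounded_clinearI)
    fix u v a
    show "?H (u + v) = ?H u + ?H v"
      unfolding H using clinear_on_add[OF lin(1) hD hD] clinear_on_add[OF lin(2) hD hD]
      by (subst uniq[of "h (u + v)" "h u + h v"]) (auto simp: hD Lh Gh scaleC_add_right)
    show "?H (a *\<^sub>C u) = a *\<^sub>C ?H u"
      unfolding H using clinear_on_scaleC[OF lin(1) hD] clinear_on_scaleC[OF lin(2) hD]
      by (subst uniq[of "h (a *\<^sub>C u)" "a *\<^sub>C h u"]) (auto simp: hD Lh Gh scaleC_scaleC mult.commute)
    have "norm (\<mu> *\<^sub>C W u - L (W u)) \<le> cmod \<mu> * norm (W u) + norm (L (W u))"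
      by (metis norm_triangle_ineq4 norm_scaleC)
    also have "\<dots> \<le> cmod \<mu> * (c * norm u) + c * norm u"
      using W by (intro add_mono mult_left_mono) auto
    finally have "norm (\<mu> *\<^sub>C W u - L (W u)) * k \<le> (cmod \<mu> * (c * norm u) + c * norm u) * k"
      using k(1) by (intro mult_right_mono) auto
    moreover have "norm (h u) \<le> norm (W u) + norm (?R (\<mu> *\<^sub>C W u - L (W u)))"
      unfolding h_def by (rule norm_triangle_ineq4)
    ultimately have "norm (h u) \<le> c * norm u + (cmod \<mu> * (c * norm u) + c * norm u) * k"
      using k(2)[of "\<mu> *\<^sub>C W u - L (W u)"] W(3)[of u] by linarith
    then show "norm (?H u) \<le> (c + (cmod \<mu> * c + c) * k) * norm u"
      by (simp add: H algebra_simps)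
  qed
  show "x = ?R (\<mu> *\<^sub>C x - L x) + ?H (G x)" if x: "x \<in> D"
  proof -
    let ?d = "x - h (G x)"
    have d: "?d \<in> ?D0" "L ?d = L x - \<mu> *\<^sub>C h (G x)"
      using clinear_on_diff[OF lin(1) x hD] clinear_on_diff[OF lin(2) x hD]
      by (auto simp: ker_on_def Gh Lh)
    then have "\<mu> *\<^sub>C ?d - L ?d = \<mu> *\<^sub>C x - L x" by (simp add: scaleC_diff_right)
    then show ?thesis using R(3)[OF d(1)] by (simp add: H)
  qed
qed

text \<open>\<open>K\<close> is bounded in the graph norm of \<open>L\<close>, and on the range of
  \<open>H\<close> that norm is controlled by the original one, since \<open>L\<close> acts there as
  multiplication by \<open>\<mu>\<close>.\<close>

lemma bounded_clinear_output:
  assumes K: "clinear_on D K" "\<And>x. x \<in> D \<Longrightarrow> norm (K x) \<le> k * graph_norm L x"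
    and H: "bounded_clinear H" "\<And>u. H u \<in> D" "\<And>u. L (H u) = \<mu> *\<^sub>C H u"
  shows "bounded_clinear (\<lambda>u. K (H u))"
proof -
  have bl: "bounded_linear H" using H(1) by (rule bounded_clinear_imp_linear)
  then obtain m where m: "m > 0" "\<And>y. norm (H y) \<le> norm y * m"
    using bounded_linear.pos_bounded by blast
  show ?thesis
  proof (rule bounded_clinearI)
    fix u v a
    show "K (H (u + v)) = K (H u) + K (H v)"
      using clinear_on_add[OF K(1) H(2) H(2), of u v] linear_add[OF bounded_linear.linear[OF bl]]
      by simp
    show "K (H (a *\<^sub>C u)) = a *\<^sub>C K (H u)"
      using clinear_on_scaleC[OF K(1) H(2), of a u] bounded_clinear_scaleC[OF H(1)] by simp
    have "norm (K (H u)) \<le> k * graph_norm L (H u)" using K(2) H(2) by blast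
    also have "\<dots> \<le> \<bar>k\<bar> * (norm (H u) + cmod \<mu> * norm (H u))"
      using graph_norm_le[of L "H u"] order_trans[OF norm_ge_zero norm_le_graph_norm(1)[of "H u" L]]
      by (intro mult_mono) (auto simp: H(3))
    also have "\<dots> \<le> \<bar>k\<bar> * (norm u * m + cmod \<mu> * (norm u * m))"
      by (intro mult_left_mono add_mono m(2)) auto
    finally show "norm (K (H u)) \<le> (\<bar>k\<bar> * (m + cmod \<mu> * m)) * norm u"
      by (simp add: algebra_simps)
  qed
qed

text \<open>Absorbs an unknown occurring on both sides: if \<open>w > (k + 1) * v\<close>, then
  \<open>k * v * (v + w) \<le> (k + 1) * v * w < w\<^sup>2\<close>.\<close>

lemma quadratic_self_bound:
  fixes k v w :: real
  assumes "0 \<le> k" "0 \<le> v" "w\<^sup>2 \<le> k * v * (v + w)"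
  shows "w \<le> (k + 1) * v"
proof (rule ccontr)
  assume "\<not> w \<le> (k + 1) * v"
  then have w: "(k + 1) * v < w" by simp
  have "0 \<le> (k + 1) * v" using assms by simp
  then have "0 < w" using w by linarith
  have "v \<le> (k + 1) * v" using assms by (simp add: distrib_right)
  then have "v < w" using w by linarith
  then have "k * v * (v + w) \<le> k * v * w + v * w"
  proof -
    have "k * v * v \<le> v * w"
    proof -
      have "k * v \<le> w" using w assms by (simp add: algebra_simps)
      then have "v * (k * v) \<le> v * w" by (intro mult_left_mono assms)
      then show ?thesis by (simp add: mult_ac)
    qed
    then show ?thesis by (simp add: distrib_left)
  qed
  also have "\<dots> = (k + 1) * v * w" by (simp add: algebra_simps)
  also have "\<dots> < w * w" using w \<open>0 < w\<close> by (intro mult_strict_right_mono)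
  finally show False using assms(3) by (simp add: power2_eq_square)
qed

text \<open>Expand the nonnegative form at \<open>k *\<^sub>R p - S p\<close> and bound
  \<open>S (S p)\<close>. This recovers \<open>S p\<close> from its quadratic form even when
  \<open>S\<close> is degenerate.\<close>

lemma norm_positive_operator_le:
  assumes S: "bounded_linear S" "\<And>u v. inner (S u) v = inner u (S v)" "\<And>u. 0 \<le> inner (S u) u"
    and k: "0 < k" "\<And>u. norm (S u) \<le> k * norm u"
  shows "(norm (S p))\<^sup>2 \<le> k * inner (S p) p"
proof -
  interpret bounded_linear S by fact
  let ?q = "S p"
  have "inner (S ?q) ?q \<le> norm (S ?q) * norm ?q" by (rule norm_cauchy_schwarz)
  also have "\<dots> \<le> k * norm ?q * norm ?q" by (intro mult_right_mono k(2)) auto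
  finally have Sq: "inner (S ?q) ?q \<le> k * inner ?q ?q"
    by (simp add: power2_eq_square mult.assoc flip: power2_norm_eq_inner)
  have "0 \<le> inner (S (k *\<^sub>R p - ?q)) (k *\<^sub>R p - ?q)" by (rule S(3))
  also have "\<dots> = k * k * inner ?q p - 2 * k * inner ?q ?q + inner (S ?q) ?q"
    using S(2)[of ?q p] by (simp add: diff scaleR inner_simps inner_commute algebra_simps)
  also have "\<dots> \<le> k * k * inner ?q p - k * inner ?q ?q" using Sq by simp
  finally have "k * inner ?q ?q \<le> k * (k * inner ?q p)" by simp
  then show ?thesis using k(1) by (simp add: power2_norm_eq_inner)
qed

text \<open>Pairing \<open>f = u + t S P u\<close> with \<open>P u\<close> discards the nonnegative
  \<open>inner u (P u)\<close> and leaves a form that controls \<open>t S P u\<close> through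
  \<open>norm_positive_operator_le\<close>. The factor \<open>norm u\<close> remaining on the right
  is absorbed by \<open>quadratic_self_bound\<close>.\<close>

lemma positive_feedback_bound:
  assumes S: "bounded_linear S" "\<And>u v. inner (S u) v = inner u (S v)" "\<And>u. 0 \<le> inner (S u) u"
    and P: "bounded_linear P" "\<And>u. 0 \<le> inner u (P u)"
  obtains c where "0 \<le> c" "\<And>t u. 0 \<le> t \<Longrightarrow> t \<le> 1 \<Longrightarrow> norm u \<le> c * norm (u + t *\<^sub>R S (P u))"
proof -
  obtain k where k: "k > 0" "\<And>u. norm (S u) \<le> k * norm u"
    using bounded_linear.pos_bounded[OF S(1)] by (metis mult.commute)
  obtain m where m: "m > 0" "\<And>u. norm (P u) \<le> m * norm u"
    using bounded_linear.pos_bounded[OF P(1)] by (metis mult.commute)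
  show thesis
  proof (rule that[of "k * m + 2"])
    fix t :: real and u assume t: "0 \<le> t" "t \<le> 1"
    let ?p = "P u"
    define f where "f = u + t *\<^sub>R S ?p"
    let ?w = "norm (t *\<^sub>R S ?p)"
    have u: "norm u \<le> norm f + ?w"
      unfolding f_def using norm_triangle_ineq4[of "u + t *\<^sub>R S ?p" "t *\<^sub>R S ?p"] by simp
    have "inner f ?p = inner u ?p + t * inner (S ?p) ?p" by (simp add: f_def inner_add_left)
    then have Sf: "t * inner (S ?p) ?p \<le> inner f ?p" using P(2)[of u] by simp
    have "?w\<^sup>2 = t * (t * (norm (S ?p))\<^sup>2)" using t by (simp add: power_mult_distrib power2_eq_square)
    also have "\<dots> \<le> 1 * (t * (norm (S ?p))\<^sup>2)" using t by (intro mult_right_mono) auto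
    also have "\<dots> \<le> 1 * (t * (k * inner (S ?p) ?p))"
      using t by (intro mult_left_mono norm_positive_operator_le[OF S k]) auto
    also have "\<dots> = k * (t * inner (S ?p) ?p)" by simp
    also have "\<dots> \<le> k * inner f ?p" using k Sf by (intro mult_left_mono) auto
    also have "\<dots> \<le> k * (norm f * (m * (norm f + ?w)))"
    proof (intro mult_left_mono)
      have "inner f ?p \<le> norm f * norm ?p" by (rule norm_cauchy_schwarz)
      also have "\<dots> \<le> norm f * (m * norm u)" by (intro mult_left_mono m) auto
      also have "\<dots> \<le> norm f * (m * (norm f + ?w))"
        using u m(1) by (intro mult_left_mono) auto
      finally show "inner f ?p \<le> norm f * (m * (norm f + ?w))" .
    qed (use k in auto)
    finally have "?w\<^sup>2 \<le> k * m * norm f * (norm f + ?w)" by (simp add: mult_ac)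
    then have "?w \<le> (k * m + 1) * norm f"
      using k m by (intro quadratic_self_bound) auto
    then show "norm u \<le> (k * m + 2) * norm (u + t *\<^sub>R S ?p)"
      using u unfolding f_def by (simp add: algebra_simps)
  qed (use k m in simp)
qed

text \<open>Provides the right inverse that \<open>transfer_H\<close> asks for when the input map is
  \<open>G + S K\<close>. At a real point \<open>l\<close> of the resolvent set of the restriction
  of \<open>L\<close> to the kernel of \<open>G\<close>, this map composed with \<open>?H\<close> is
  \<open>1 + S P\<close>, where \<open>P\<close> is positive by impedance passivity. The method of
  continuity inverts it, and \<open>W\<close> is \<open>?H\<close> after the inverse
  \<open>V\<close>.\<close>

lemma boundary_node_feedback:
  fixes G :: "'x::chilbert_space \<Rightarrow> 'u::chilbert_space"
  assumes node: "boundary_node D G L K" and pass: "impedance_passive D G L K"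
    and S: "bounded_clinear S" "\<And>u v. inner (S u) v = inner u (S v)" "\<And>u. 0 \<le> inner (S u) u"
  obtains W c where "\<And>u. W u \<in> D" "\<And>u. G (W u) + S (K (W u)) = u"
    "\<And>u. norm (W u) \<le> c * norm u" "\<And>u. norm (L (W u)) \<le> c * norm u"
proof -
  from node have lin: "clinear_on D L" "clinear_on D G" "clinear_on D K"
    by (auto simp: boundary_node_def)
  from node obtain k where k: "\<And>x. x \<in> D \<Longrightarrow> norm (K x) \<le> k * graph_norm L x"
    by (auto simp: boundary_node_def)
  from node obtain Gr g where Gr: "\<And>u. Gr u \<in> D" "\<And>u. G (Gr u) = u"
    "\<And>u. graph_norm L (Gr u) \<le> g * norm u"
    unfolding boundary_node_def by blast
  from node obtain T where T: "C0_semigroup T" "is_generator T (ker_on D G) L"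
    by (auto simp: boundary_node_def generates_C0_semigroup_def)
  have diss: "inner (L x) x \<le> inner (G x) (K x)" if "x \<in> D" for x
    using pass that by (simp add: impedance_passive_def Re_cinner)
  obtain l where l: "0 < l" "\<And>y. \<exists>x\<in>ker_on D G. l *\<^sub>R x - L x = y"
    using generator_shift_surj[OF T] by blast
  have res: "complex_of_real l \<in> resolvent_set (ker_on D G) L"
  proof (rule resolvent_setI(1)[OF clinear_on_ker_on[OF lin(1,2)], where c = "1 / l"])
    fix x assume x: "x \<in> ker_on D G"
    then have "inner (L x) x \<le> 0" using diss[of x] by (simp add: ker_on_def)
    from dissipative_shift_bound[where A = L, OF this, of "complex_of_real l"]
    show "norm x \<le> 1 / l * norm (complex_of_real l *\<^sub>C x - L x)"
      using l(1) by (simp add: field_simps)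
  qed (use l(2) in \<open>simp add: scaleC_complex_of_real\<close>)
  let ?H = "transfer_H D G L (complex_of_real l)"
  have "norm (Gr u) \<le> g * norm u" "norm (L (Gr u)) \<le> g * norm u" for u
    using Gr(3)[of u] order_trans[OF norm_le_graph_norm(1)] order_trans[OF norm_le_graph_norm(2)] by auto
  note H = transfer_H[OF lin(1,2) res Gr(1,2) this]
  define P where "P u = K (?H u)" for u
  have P: "bounded_clinear P"
    unfolding P_def using lin(3) k H(4,1,2) by (rule bounded_clinear_output)
  have Ppos: "0 \<le> inner u (P u)" for u
  proof -
    have "0 \<le> inner (L (?H u)) (?H u)" using l(1) by (simp add: H(2) inner_scaleC_self)
    also have "\<dots> \<le> inner u (P u)" using diss[OF H(1)] by (simp add: H(3) P_def)
    finally show ?thesis .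
  qed
  have SP: "bounded_clinear (\<lambda>u. S (P u))" using S(1) P by (rule bounded_clinear_compose)
  obtain c where c: "0 \<le> c" "\<And>t u. 0 \<le> t \<Longrightarrow> t \<le> 1 \<Longrightarrow> norm u \<le> c * norm (u + t *\<^sub>R S (P u))"
    using positive_feedback_bound[OF bounded_clinear_imp_linear[OF S(1)] S(2,3)
        bounded_clinear_imp_linear[OF P] Ppos] by blast
  have "\<exists>u. u + S (P u) = f" for f
  proof (rule continuity_method[OF bounded_clinear_imp_linear[OF SP]])
    fix t :: real and u :: 'u assume t: "0 < t" "t \<le> 1"
    then have "t * norm u \<le> norm u" by (simp add: mult_left_le_one_le)
    also have "\<dots> \<le> c * norm (u + t *\<^sub>R S (P u))" using c t by simp
    finally show "t * norm u \<le> c * norm (u + t *\<^sub>R S (P u))" .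
  qed
  then obtain V where V: "\<And>f. V f + S (P (V f)) = f" by metis
  have VC: "norm (V f) \<le> c * norm f" for f using c(2)[of 1 "V f"] by (simp add: V)
  obtain m where m: "m > 0" "\<And>u. norm (?H u) \<le> m * norm u"
    using bounded_linear.pos_bounded[OF bounded_clinear_imp_linear[OF H(4)]] by (metis mult.commute)
  have HV: "norm (?H (V f)) \<le> m * c * norm f" for f
  proof -
    have "m * norm (V f) \<le> m * (c * norm f)" using VC m(1) by (intro mult_left_mono) auto
    then show ?thesis using m(2)[of "V f"] by (simp add: mult.assoc)
  qed
  show thesis
  \<comment> \<open>The factor \<open>1 + l\<close> lets one constant bound both \<open>W\<close>
    and \<open>L W\<close>, as \<open>L\<close> multiplies the range of \<open>?H\<close> by
    \<open>l\<close>.\<close>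
  proof (rule that[of "\<lambda>f. ?H (V f)" "(1 + l) * (m * c)"])
    fix f
    show "?H (V f) \<in> D" by (rule H(1))
    show "G (?H (V f)) + S (K (?H (V f))) = f" using V[of f] by (simp add: H(3) P_def)
    have nonneg: "0 \<le> m * c * norm f" "0 \<le> l * (m * c * norm f)" using m c l(1) by simp_all
    have eq: "(1 + l) * (m * c) * norm f = m * c * norm f + l * (m * c * norm f)"
      by (simp add: distrib_right)
    show "norm (?H (V f)) \<le> (1 + l) * (m * c) * norm f"
      unfolding eq using HV[of f] nonneg by linarith
    have "norm (L (?H (V f))) \<le> l * (m * c * norm f)"
      using HV[of f] l(1) by (simp add: H(2) mult_left_mono)
    then show "norm (L (?H (V f))) \<le> (1 + l) * (m * c) * norm f"
      unfolding eq using nonneg by linarith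
  qed
qed

section \<open>The coupled system\<close>

lemma bounded_clinear_simps:
  assumes "bounded_clinear T"
  shows "T (x + y) = T x + T y" "T (x - y) = T x - T y" "T (- x) = - T x" "T 0 = 0"
    "T (c *\<^sub>C x) = c *\<^sub>C T x"
  using assms
  by (simp_all add: bounded_clinear_def bounded_linear.linear linear_add linear_diff linear_neg linear_0)

locale coupled_system =
  fixes DL1 :: "'x1::chilbert_space set" and DA2 :: "'x2::chilbert_space set"
    and L1 :: "'x1 \<Rightarrow> 'x1" and G1 K1 :: "'x1 \<Rightarrow> 'u1::chilbert_space"
    and A2 :: "'x2 \<Rightarrow> 'x2" and B2 :: "'u2::chilbert_space \<Rightarrow> 'x2"
    and C2 :: "'x2 \<Rightarrow> 'u2" and D2 :: "'u2 \<Rightarrow> 'u2"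
    and J :: "'u1 \<Rightarrow> 'u2" and Q :: "'u2 \<Rightarrow> 'u2"
  assumes node: "boundary_node DL1 G1 L1 K1"
    and impedance: "impedance_passive DL1 G1 L1 K1"
    and lin_A2: "clinear_on DA2 A2"
    and B2: "bounded_clinear B2" and C2: "bounded_clinear C2" and D2: "bounded_clinear D2"
    and passive2: "\<And>x u. x \<in> DA2 \<Longrightarrow> inner (A2 x + B2 u) x \<le> inner (C2 x + D2 u) u"
    and J: "bounded_clinear J"
    and Q: "selfadjoint Q" and Q_ge: "op_ge Q (\<lambda>_. 0)"
begin

abbreviation "Ja \<equiv> cadjoint J"
abbreviation "G0 \<equiv> feedback_input G1 K1 J Q"
abbreviation "D0 \<equiv> ker_on DL1 G0"
abbreviation "Dom \<equiv> coupled_dom DL1 G1 K1 J DA2 C2 D2"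
abbreviation "A \<equiv> coupled_op L1 K1 J A2 B2"

lemma lin: "clinear_on DL1 L1" "clinear_on DL1 G1" "clinear_on DL1 K1"
  using node by (auto simp: boundary_node_def)

lemma passive1: "x \<in> DL1 \<Longrightarrow> inner (L1 x) x \<le> inner (G1 x) (K1 x)"
  using impedance by (simp add: impedance_passive_def Re_cinner)

lemma Ja: "bounded_clinear Ja"
  using J by (rule bounded_clinear_cadjoint)

lemma inner_J: "inner (J x) y = inner x (Ja y)"
  using J by (rule inner_cadjoint)

lemma inner_Ja: "inner (Ja y) x = inner y (J x)"
  by (metis inner_J inner_commute)

lemma Q_bc: "bounded_clinear Q" and Q_sym: "inner (Q x) y = inner x (Q y)"
  and Q_pos: "0 \<le> inner (Q x) x"
proof -
  show Q': "bounded_clinear Q" using Q by (simp add: selfadjoint_def)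
  show "inner (Q x) y = inner x (Q y)"
    using inner_cadjoint[OF Q', of x y] Q by (simp add: selfadjoint_def)
  show "0 \<le> inner (Q x) x" using Q_ge by (simp add: op_ge_def Re_cinner)
qed

lemma clinear_on_feedback:
  assumes P: "bounded_clinear P"
  shows "clinear_on DL1 (feedback_input G1 K1 J P)"
  unfolding clinear_on_def feedback_input_def
  using clinear_on_0[OF lin(2)] clinear_on_add[OF lin(2)] clinear_on_add[OF lin(3)]
    clinear_on_scaleC[OF lin(2)] clinear_on_scaleC[OF lin(3)]
  by (auto simp: bounded_clinear_simps[OF J] bounded_clinear_simps[OF P]
      bounded_clinear_simps[OF Ja] scaleC_add_right)

lemma clinear_on_A: "clinear_on Dom A"
proof -
  note F = clinear_on_feedback[OF D2]
  show ?thesis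
    unfolding clinear_on_def
    using clinear_on_0[OF F] clinear_on_add[OF F] clinear_on_scaleC[OF F]
      clinear_on_0[OF lin_A2] clinear_on_add[OF lin_A2] clinear_on_scaleC[OF lin_A2]
      clinear_on_add[OF lin(1)] clinear_on_add[OF lin(3)]
      clinear_on_scaleC[OF lin(1)] clinear_on_scaleC[OF lin(3)]
    by (auto simp: coupled_dom_def coupled_op_def scaleC_prod_def zero_prod_def
        bounded_clinear_simps[OF J] bounded_clinear_simps[OF B2] bounded_clinear_simps[OF C2]
        bounded_clinear_simps[OF Ja] scaleC_add_right scaleC_diff_right scaleC_minus_right)
qed

text \<open>The second system receives the input \<open>- ?z\<close>, and with the boundary
  condition the supply terms of the two passivity inequalities cancel.\<close>

lemma dissipative_A:
  assumes "x \<in> Dom"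
  shows "inner (A x) x \<le> 0"
proof -
  obtain x1 x2 where x: "x = (x1, x2)" by force
  let ?z = "J (K1 x1)"
  have D: "x1 \<in> DL1" "x2 \<in> DA2" and G: "G1 x1 + Ja (D2 ?z) = Ja (C2 x2)"
    using assms by (auto simp: x coupled_dom_def feedback_input_def)
  have neg: "B2 (- ?z) = - B2 ?z" "D2 (- ?z) = - D2 ?z"
    by (rule bounded_clinear_simps[OF B2] bounded_clinear_simps[OF D2])+
  have "inner (L1 x1) x1 \<le> inner (G1 x1) (K1 x1)" using D(1) by (rule passive1)
  also have "G1 x1 = Ja (C2 x2) - Ja (D2 ?z)" using G by (simp add: eq_diff_eq)
  also have "inner \<dots> (K1 x1) = inner (C2 x2) ?z - inner (D2 ?z) ?z"
    by (simp add: inner_diff_left inner_Ja)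
  finally have "inner (L1 x1) x1 \<le> inner (C2 x2) ?z - inner (D2 ?z) ?z" .
  moreover have "inner (A2 x2) x2 - inner (B2 ?z) x2 \<le> inner (D2 ?z) ?z - inner (C2 x2) ?z"
    using passive2[OF D(2), of "- ?z"] by (simp add: neg inner_simps)
  ultimately show ?thesis by (simp add: x coupled_op_def inner_simps)
qed

text \<open>
  Here \<open>\<mu>\<close> stands for a point of \<open>\<i>E\<close>, and \<open>P\<close> is the transfer function of the second
  system at \<open>\<mu>\<close>.
\<close>

context
  fixes \<mu> :: complex and \<eta> :: real and P
  assumes Re_mu: "Re \<mu> = 0"
    and res0: "\<mu> \<in> resolvent_set D0 L1" and res2: "\<mu> \<in> resolvent_set DA2 A2"
    and eta: "0 < \<eta>"
  defines "P \<equiv> \<lambda>u. C2 (resolvent DA2 A2 \<mu> (B2 u)) + D2 u"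
  assumes P_ge: "\<And>u. \<eta> * (norm u)\<^sup>2 \<le> inner (P u) u"
begin

abbreviation "R0 \<equiv> resolvent D0 L1 \<mu>"
abbreviation "R2 \<equiv> resolvent DA2 A2 \<mu>"
abbreviation "H \<equiv> transfer_H DL1 G0 L1 \<mu>"

text \<open>\<open>boundary_node_feedback\<close> with the positive operator \<open>Ja Q J\<close>
  supplies the right inverse of \<open>G0\<close> that \<open>transfer_H\<close> requires.\<close>

lemma transfer_H_facts:
  shows "H u \<in> DL1" "L1 (H u) = \<mu> *\<^sub>C H u" "G0 (H u) = u" "bounded_clinear H"
    "x \<in> DL1 \<Longrightarrow> x = R0 (\<mu> *\<^sub>C x - L1 x) + H (G0 x)"
proof -
  let ?S = "\<lambda>u. Ja (Q (J u))"
  have "bounded_clinear ?S"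
    using bounded_clinear_compose[OF Ja bounded_clinear_compose[OF Q_bc J]] .
  moreover have "inner (?S u) v = inner u (?S v)" for u v
    by (simp add: inner_Ja Q_sym inner_J)
  moreover have "0 \<le> inner (?S u) u" for u
    by (simp add: inner_Ja Q_pos)
  ultimately obtain W c where W: "\<And>u. W u \<in> DL1" "\<And>u. G1 (W u) + ?S (K1 (W u)) = u"
    "\<And>u. norm (W u) \<le> c * norm u" "\<And>u. norm (L1 (W u)) \<le> c * norm u"
    using boundary_node_feedback[OF node impedance] by metis
  have "G0 (W u) = u" for u using W(2) by (simp add: feedback_input_def)
  note H = transfer_H[OF lin(1) clinear_on_feedback[OF Q_bc] res0 W(1) this W(3,4)]
  show "H u \<in> DL1" "L1 (H u) = \<mu> *\<^sub>C H u" "G0 (H u) = u" "bounded_clinear H"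
    "x \<in> DL1 \<Longrightarrow> x = R0 (\<mu> *\<^sub>C x - L1 x) + H (G0 x)"
    by (rule H; assumption)+
qed

lemma K1_H: "bounded_clinear (\<lambda>u. K1 (H u))"
proof -
  obtain k where "\<And>x. x \<in> DL1 \<Longrightarrow> norm (K1 x) \<le> k * graph_norm L1 x"
    using node by (auto simp: boundary_node_def)
  with lin(3) show ?thesis using transfer_H_facts(4,1,2) by (rule bounded_clinear_output)
qed

lemma R2: "R2 y \<in> DA2" "\<mu> *\<^sub>C R2 y - A2 (R2 y) = y"
  "x \<in> DA2 \<Longrightarrow> R2 (\<mu> *\<^sub>C x - A2 x) = x" "bounded_clinear R2"
  by (fact resolvent[OF res2])+

lemma P_bc: "bounded_clinear P"
  unfolding P_def
  by (intro bounded_clinear_add bounded_clinear_compose[OF C2]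
      bounded_clinear_compose[OF R2(4)] B2 D2)

lemma linear_facts:
  shows "B2 (u - v) = B2 u - B2 v" "C2 (x - y) = C2 x - C2 y" "R2 (x - y) = R2 x - R2 y"
    "Ja (u - v) = Ja u - Ja v" "Ja (u + v) = Ja u + Ja v"
  by (simp_all add: bounded_clinear_simps[OF B2] bounded_clinear_simps[OF C2]
      bounded_clinear_simps[OF R2(4)] bounded_clinear_simps[OF Ja])

text \<open>On the imaginary axis \<open>inner (L1 x) x\<close> vanishes for
  \<open>x = H (Ja v)\<close>, so impedance passivity makes \<open>inner (G1 x) (K1 x)\<close>
  nonnegative; writing \<open>G1\<close> as \<open>G0\<close> minus the feedback brings in
  \<open>Q\<close>.\<close>

lemma transfer_positive:
  "inner (Q (J (K1 (H (Ja v))))) (J (K1 (H (Ja v)))) \<le> inner v (J (K1 (H (Ja v))))"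
proof -
  let ?x = "H (Ja v)"
  have "0 = inner (L1 ?x) ?x" by (simp add: transfer_H_facts(2) inner_scaleC_self Re_mu)
  also have "\<dots> \<le> inner (G1 ?x) (K1 ?x)" using transfer_H_facts(1) by (rule passive1)
  also have "G1 ?x = Ja v - Ja (Q (J (K1 ?x)))"
    using transfer_H_facts(3)[of "Ja v"] by (simp add: feedback_input_def eq_diff_eq)
  finally show ?thesis by (simp add: inner_diff_left inner_Ja)
qed

text \<open>Eliminating \<open>x2\<close> turns the boundary condition into
  \<open>G1 x1 = Ja (C2 (R2 y2) - P z)\<close>. Inserted into the passivity inequality this is the
  energy balance; after adding \<open>Ja (Q z)\<close> it prescribes \<open>G0 x1\<close>, and with
  it \<open>x1\<close>.\<close>

lemma coupled_solution_facts:
  assumes x: "(x1, x2) \<in> Dom" and y: "\<mu> *\<^sub>C (x1, x2) - A (x1, x2) = (y1, y2)"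
  defines "z \<equiv> J (K1 x1)"
  shows "\<eta> * (norm z)\<^sup>2 \<le> norm y1 * norm x1 + norm (C2 (R2 y2)) * norm z"
    and "x1 = R0 y1 + H (Ja (C2 (R2 y2) - (P z - Q z)))"
    and "x2 = R2 (y2 - B2 z)"
proof -
  have D: "x1 \<in> DL1" "x2 \<in> DA2" and G: "G1 x1 + Ja (D2 z) = Ja (C2 x2)"
    using x by (auto simp: coupled_dom_def feedback_input_def z_def)
  have y1: "\<mu> *\<^sub>C x1 - L1 x1 = y1" and y2: "\<mu> *\<^sub>C x2 - A2 x2 = y2 - B2 z"
    using y by (auto simp: coupled_op_def scaleC_prod_def z_def algebra_simps)
  show x2: "x2 = R2 (y2 - B2 z)" using R2(3)[OF D(2)] y2 by simp
  have "C2 x2 - D2 z = C2 (R2 y2) - P z"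
    unfolding x2 by (simp add: P_def linear_facts)
  then have G1: "G1 x1 = Ja (C2 (R2 y2) - P z)"
    using G by (metis add_diff_cancel_right' linear_facts(4))
  then have "G0 x1 = Ja (C2 (R2 y2) - P z + Q z)"
    by (simp only: feedback_input_def linear_facts(5) z_def)
  then show "x1 = R0 y1 + H (Ja (C2 (R2 y2) - (P z - Q z)))"
    using transfer_H_facts(5)[OF D(1)] y1 by (simp add: algebra_simps)
  have "- inner y1 x1 = inner (L1 x1) x1"
    by (simp add: y1[symmetric] inner_diff_left inner_scaleC_self Re_mu)
  also have "\<dots> \<le> inner (G1 x1) (K1 x1)" using D(1) by (rule passive1)
  also have "\<dots> = inner (C2 (R2 y2)) z - inner (P z) z"
    by (simp add: G1 inner_Ja inner_diff_left z_def)
  finally have "inner (P z) z \<le> inner y1 x1 + inner (C2 (R2 y2)) z" by simp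
  then show "\<eta> * (norm z)\<^sup>2 \<le> norm y1 * norm x1 + norm (C2 (R2 y2)) * norm z"
    using P_ge[of z] norm_cauchy_schwarz[of y1 x1] norm_cauchy_schwarz[of "C2 (R2 y2)" z]
    by linarith
qed

text \<open>Both components are determined by \<open>z\<close>, so only the consistency condition
  \<open>J (K1 x1) = z\<close> has to be solved, which is the equation
  \<open>z + T (P z - Q z) = f\<close>.\<close>

lemma coupled_surj: "\<exists>x\<in>Dom. \<mu> *\<^sub>C x - A x = y"
proof -
  obtain y1 y2 where y: "y = (y1, y2)" by force
  define T where "T v = J (K1 (H (Ja v)))" for v
  have T: "bounded_clinear T"
    unfolding T_def
    using bounded_clinear_compose[OF J bounded_clinear_compose[OF K1_H Ja]] .
  have Tl: "linear T" using T by (simp add: bounded_clinear_def bounded_linear.linear)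
  have PQ: "bounded_clinear (\<lambda>z. P z - Q z)"
    using P_bc Q_bc by (rule bounded_clinear_diff)
  obtain m where m: "m > 0" "\<And>u. norm (P u - Q u) \<le> m * norm u"
    using bounded_linear.pos_bounded[OF bounded_clinear_imp_linear[OF PQ]] by (metis mult.commute)
  obtain q where q: "q > 0" "\<And>u. norm (Q u) \<le> q * norm u"
    using bounded_linear.pos_bounded[OF bounded_clinear_imp_linear[OF Q_bc]] by (metis mult.commute)
  have Ql: "linear Q" using Q_bc by (simp add: bounded_clinear_def bounded_linear.linear)
  define f where "f = J (K1 (R0 y1)) + T (C2 (R2 y2))"
  have "\<exists>z. z + T (P z - Q z) = f"
  proof (rule continuity_method)
    show "bounded_linear (\<lambda>z. T (P z - Q z))"
      using bounded_clinear_compose[OF T PQ] by (rule bounded_clinear_imp_linear)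
    fix t :: real and z :: 'u2
    assume t: "0 < t" "t \<le> 1"
    let ?d = "P z - Q z"
    define g where "g = z + t *\<^sub>R T ?d"
    \<comment> \<open>Since \<open>T v = z - g\<close>, \<open>transfer_positive\<close> at this
      \<open>v\<close> relates \<open>z\<close> to the right-hand side \<open>g\<close>.\<close>
    define v where "v = - (t *\<^sub>R ?d)"
    have Tv: "T v = z - g" by (simp add: v_def g_def linear_neg[OF Tl] linear_cmul[OF Tl])
    have "inner (Q (z - g)) (z - g) \<le> inner v (z - g)"
      using transfer_positive[of v] unfolding T_def[symmetric] Tv .
    moreover have "inner (Q (z - g)) (z - g) = inner (Q z) z - 2 * inner (Q z) g + inner (Q g) g"
      using Q_sym[of g z] by (simp add: linear_diff[OF Ql] inner_simps inner_commute)
    moreover have "inner v (z - g) = - t * inner (P z) z + t * inner (Q z) z + t * inner ?d g"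
      by (simp add: v_def inner_simps algebra_simps)
    \<comment> \<open>The term \<open>t * inner (Q z) z\<close> is absorbed by
      \<open>inner (Q z) z\<close> because \<open>t \<le> 1\<close>; what remains is the coercivity
      of \<open>P\<close>, weighted by \<open>t\<close>.\<close>
    ultimately have "t * inner (P z) z
        \<le> - ((1 - t) * inner (Q z) z) + t * inner ?d g + 2 * inner (Q z) g - inner (Q g) g"
      by (simp add: algebra_simps)
    moreover have "0 \<le> (1 - t) * inner (Q z) z" using t Q_pos by simp
    moreover note Q_pos[of g]
    moreover have "t * inner ?d g \<le> m * norm z * norm g"
    proof -
      have "t * inner ?d g \<le> t * (norm ?d * norm g)"
        using t by (intro mult_left_mono norm_cauchy_schwarz) auto
      also have "\<dots> \<le> 1 * (norm ?d * norm g)" using t by (intro mult_right_mono) auto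
      also have "\<dots> \<le> m * norm z * norm g" using m(2)[of z] by (simp add: mult_right_mono)
      finally show ?thesis .
    qed
    moreover have "inner (Q z) g \<le> q * norm z * norm g"
      using norm_cauchy_schwarz[of "Q z" g] mult_right_mono[OF q(2)[of z] norm_ge_zero[of g]]
      by linarith
    moreover have "t * (\<eta> * (norm z)\<^sup>2) \<le> t * inner (P z) z"
      using t P_ge by (intro mult_left_mono) auto
    ultimately have "t * (\<eta> * (norm z)\<^sup>2) \<le> m * norm z * norm g + 2 * (q * norm z * norm g)"
      by linarith
    then have "norm z * (t * \<eta> * norm z) \<le> norm z * ((m + 2 * q) * norm g)"
      by (simp add: power2_eq_square algebra_simps)
    then have "t * \<eta> * norm z \<le> (m + 2 * q) * norm g"
      using m(1) q(1) by (cases "z = 0") auto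
    then show "t * norm z \<le> (m + 2 * q) / \<eta> * norm (z + t *\<^sub>R T (P z - Q z))"
      using eta by (simp add: g_def field_simps)
  qed
  then obtain z where z: "z + T (P z - Q z) = f" ..
  \<comment> \<open>\<open>Ja w\<close> is the value of \<open>G0 x1\<close> that the boundary
    condition demands.\<close>
  define w where "w = C2 (R2 y2) - (P z - Q z)"
  define x1 where "x1 = R0 y1 + H (Ja w)"
  define x2 where "x2 = R2 (y2 - B2 z)"
  have R0: "R0 y1 \<in> DL1" "G0 (R0 y1) = 0" "\<mu> *\<^sub>C R0 y1 - L1 (R0 y1) = y1"
    using resolvent_mem[OF res0, of y1] resolvent_eq[OF res0, of y1] by (auto simp: ker_on_def)
  note add = clinear_on_add[OF _ R0(1) transfer_H_facts(1), of _ "Ja w"]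
  have x1: "x1 \<in> DL1" "L1 x1 = L1 (R0 y1) + \<mu> *\<^sub>C H (Ja w)" "G0 x1 = Ja w"
    "K1 x1 = K1 (R0 y1) + K1 (H (Ja w))"
    using add[OF lin(1)] add[OF lin(3)] add[OF clinear_on_feedback[OF Q_bc]]
    by (auto simp: x1_def transfer_H_facts R0)
  have "J (K1 x1) = J (K1 (R0 y1)) + T w"
    by (simp add: x1(4) T_def bounded_clinear_simps[OF J])
  also have "\<dots> = f - T (P z - Q z)"
    by (simp add: f_def w_def linear_diff[OF Tl])
  also have "\<dots> = z" using z by (simp add: diff_eq_eq)
  finally have Jz: "J (K1 x1) = z" .
  have Ja_eq: "G1 x1 + Ja (D2 z) = Ja (C2 x2)"
  proof -
    have "G1 x1 + Ja (Q z) = Ja w" using x1(3) by (simp add: feedback_input_def Jz)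
    then have "G1 x1 + Ja (D2 z) = Ja (w - Q z + D2 z)"
      by (simp add: linear_facts eq_diff_eq)
    also have "w - Q z + D2 z = C2 x2"
      by (simp add: w_def x2_def P_def linear_facts)
    finally show ?thesis .
  qed
  have "(x1, x2) \<in> Dom"
    using x1(1) R2(1) Ja_eq by (simp add: coupled_dom_def feedback_input_def Jz x2_def)
  moreover have "\<mu> *\<^sub>C (x1, x2) - A (x1, x2) = y"
  proof -
    have "\<mu> *\<^sub>C x1 - L1 x1 = y1"
      using R0(3) by (simp add: x1(2)) (simp add: x1_def scaleC_add_right)
    moreover have "\<mu> *\<^sub>C x2 - (- B2 z + A2 x2) = y2"
      using R2(2)[of "y2 - B2 z"] by (simp add: x2_def algebra_simps)
    ultimately show ?thesis by (simp add: y coupled_op_def scaleC_prod_def Jz)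
  qed
  ultimately show ?thesis by blast
qed

end

end

text \<open>
  With \<open>w = N M z\<close> and \<open>v = (M0 + N\<^sup>2 M\<^sup>2 / \<eta>) Y\<close> the first two hypotheses become
  \<open>w\<^sup>2 \<le> k v (v + w)\<close> for a constant \<open>k\<close>. The bound \<open>\<eta> \<le> p M\<close> absorbs the terms
  \<open>N M\<close> and \<open>M\<close> into \<open>N\<^sup>2 M\<^sup>2 / \<eta>\<close>.
\<close>

lemma coupled_estimate:
  fixes r b p :: real
  assumes "0 < r" "0 < b" "0 < p"
  obtains C where "0 < C"
    "\<And>N M0 M \<eta> a1 a2 z Y. \<lbrakk>r \<le> N; r \<le> M; 0 \<le> M0; 0 < \<eta>; \<eta> \<le> p * M; 0 \<le> a1; 0 \<le> z; 0 \<le> Y;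
      \<eta> * z\<^sup>2 \<le> Y * a1 + b * M * Y * z; a1 \<le> M0 * Y + N * (b * (b * M * Y + p * M * z));
      a2 \<le> M * (Y + b * z)\<rbrakk> \<Longrightarrow> a1 + a2 \<le> C * (M0 + N\<^sup>2 * M\<^sup>2 / \<eta>) * Y"
proof -
  define k1 where "k1 = 1 + b * b * p / r"
  define k2 where "k2 = b * p"
  define k where "k = k1 + k2 + b / r"
  define C where "C = k1 + k2 * (k + 1) + p / r\<^sup>2 + b / r * (k + 1)"
  have pos: "0 < k1" "0 < k2" "0 < k" "0 < C"
    using assms by (auto simp: k1_def k2_def k_def C_def intro!: add_pos_nonneg add_nonneg_nonneg)
  show thesis
  proof (rule that[OF pos(4)])
    fix N M0 M \<eta> a1 a2 z Y :: real
    assume r: "r \<le> N" "r \<le> M" and M0: "0 \<le> M0" and \<eta>: "0 < \<eta>" "\<eta> \<le> p * M"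
      and nonneg: "0 \<le> a1" "0 \<le> z" "0 \<le> Y"
      and E1: "\<eta> * z\<^sup>2 \<le> Y * a1 + b * M * Y * z"
      and E2: "a1 \<le> M0 * Y + N * (b * (b * M * Y + p * M * z))"
      and E3: "a2 \<le> M * (Y + b * z)"
    have NM: "0 < N" "0 < M" using r assms by auto
    define F where "F = N\<^sup>2 * M\<^sup>2 / \<eta>"
    have F: "0 < F" "F * \<eta> = N\<^sup>2 * M\<^sup>2" using NM \<eta> by (auto simp: F_def)
    define v where "v = (M0 + F) * Y"
    define w where "w = N * M * z"
    have v: "0 \<le> v" "M0 * Y \<le> v" "F * Y \<le> v"
      using M0 F nonneg by (auto simp: v_def distrib_right)
    have w: "0 \<le> w" using NM nonneg by (simp add: w_def)
    \<comment> \<open>Cancelling one factor \<open>M\<close> gives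
      \<open>N * (N * M) \<le> p * F\<close>; the lower bound \<open>r\<close> on \<open>N\<close>
      then removes the remaining factors \<open>N\<close> one at a time.\<close>
    have "F * \<eta> \<le> F * (p * M)" using F \<eta> by (intro mult_left_mono) auto
    then have "(N * N) * M * M \<le> (p * F) * M" using F(2) by (simp add: power2_eq_square mult_ac)
    then have "N * (N * M) \<le> p * F" using NM by (simp add: mult.assoc)
    moreover have "r * (N * M) \<le> N * (N * M)" using NM r by (intro mult_right_mono) auto
    ultimately have NM_le: "N * M \<le> p / r * F" using assms by (simp add: field_simps)
    have "r * M \<le> N * M" using NM r by (intro mult_right_mono) auto
    then have "r * M \<le> p / r * F" using NM_le by linarith
    then have M_le: "M \<le> p / r\<^sup>2 * F" using assms by (simp add: field_simps power2_eq_square)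
    have "r * (M * z) \<le> N * (M * z)" using NM r nonneg by (intro mult_right_mono) auto
    then have Mz: "M * z \<le> w / r" using assms by (simp add: w_def field_simps)
    have "N * M * Y \<le> p / r * F * Y" using NM_le nonneg by (intro mult_right_mono) auto
    also have "\<dots> \<le> p / r * v" using v(3) assms by (simp add: mult.assoc mult_left_mono divide_right_mono)
    finally have NMY: "b * b * (N * M * Y) \<le> b * b * (p / r * v)"
      using assms by (intro mult_left_mono) auto
    have "M0 * Y + N * (b * (b * M * Y + p * M * z)) = M0 * Y + b * b * (N * M * Y) + k2 * w"
      by (simp add: k2_def w_def algebra_simps)
    also have "\<dots> \<le> v + b * b * (p / r * v) + k2 * w" using v NMY by simp
    also have "\<dots> = k1 * v + k2 * w" by (simp add: k1_def algebra_simps)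
    finally have a1: "a1 \<le> k1 * v + k2 * w" using E2 by simp
    \<comment> \<open>Multiplying the energy inequality by \<open>F\<close> turns its left side into
      \<open>w\<^sup>2\<close>.\<close>
    have "w\<^sup>2 = F * \<eta> * z\<^sup>2" unfolding F(2) by (simp add: w_def power_mult_distrib)
    also have "\<dots> \<le> F * (Y * a1 + b * M * Y * z)"
      unfolding mult.assoc[of F] using E1 F by (intro mult_left_mono) auto
    also have "\<dots> = F * Y * (a1 + b * (M * z))" by (simp add: algebra_simps)
    also have "\<dots> \<le> v * (a1 + b * (M * z))"
      using v nonneg NM assms by (intro mult_right_mono) auto
    also have "\<dots> \<le> v * (k1 * v + k2 * w + b * (w / r))"
      using a1 Mz assms v by (intro mult_left_mono add_mono) auto
    also have "\<dots> \<le> v * (k * v + k * w)"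
    proof (intro mult_left_mono v(1))
      have "k1 * v \<le> k * v" using pos assms v by (intro mult_right_mono) (auto simp: k_def)
      moreover have "(k2 + b / r) * w \<le> k * w"
        using pos w by (intro mult_right_mono) (auto simp: k_def)
      ultimately show "k1 * v + k2 * w + b * (w / r) \<le> k * v + k * w"
        by (simp add: distrib_right)
    qed
    finally have "w\<^sup>2 \<le> k * v * (v + w)" by (simp add: algebra_simps)
    then have w_le: "w \<le> (k + 1) * v" using pos v by (intro quadratic_self_bound) auto
    have "a1 \<le> k1 * v + k2 * ((k + 1) * v)"
      using a1 mult_left_mono[OF w_le, of k2] pos by linarith
    moreover have "a2 \<le> p / r\<^sup>2 * v + b * ((k + 1) * v / r)"
    proof -
      have "M * Y \<le> p / r\<^sup>2 * F * Y" using M_le nonneg by (intro mult_right_mono) auto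
      also have "\<dots> \<le> p / r\<^sup>2 * v"
        using v(3) assms by (simp add: mult.assoc mult_left_mono divide_right_mono)
      finally have "M * Y \<le> p / r\<^sup>2 * v" .
      moreover have "M * z \<le> (k + 1) * v / r"
        using Mz divide_right_mono[OF w_le, of r] assms by linarith
      then have "b * (M * z) \<le> b * ((k + 1) * v / r)" using assms by (intro mult_left_mono) auto
      moreover have "M * (Y + b * z) = M * Y + b * (M * z)" by (simp add: algebra_simps)
      ultimately show ?thesis using E3 by linarith
    qed
    ultimately have "a1 + a2 \<le> C * v" by (simp add: C_def algebra_simps)
    then show "a1 + a2 \<le> C * (M0 + N\<^sup>2 * M\<^sup>2 / \<eta>) * Y" by (simp add: v_def F_def mult.assoc)
  qed
qed

section \<open>From real parts and operator norms to pointwise estimates\<close>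

lemma inner_op_Re:
  assumes "bounded_clinear T"
  shows "inner (op_Re T x) x = inner (T x) x"
proof -
  have "inner (cadjoint T x) x = inner (T x) x"
    by (metis inner_cadjoint[OF assms] inner_commute)
  then show ?thesis by (simp add: op_Re_def inner_add_left)
qed

lemma norm_le_onorm_bound:
  "bounded_linear T \<Longrightarrow> onorm T \<le> k \<Longrightarrow> norm (T x) \<le> k * norm x"
  using onorm[of T x] mult_right_mono[OF _ norm_ge_zero[of x], of "onorm T" k] by linarith

theorem theorem3p8:
  fixes DL1 :: "'x1::chilbert_space set" and DA2 :: "'x2::chilbert_space set"
    and L1 :: "'x1 \<Rightarrow> 'x1" and G1 K1 :: "'x1 \<Rightarrow> 'u1::chilbert_space"
    and A2 :: "'x2 \<Rightarrow> 'x2" and B2 :: "'u2::chilbert_space \<Rightarrow> 'x2"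
    and C2 :: "'x2 \<Rightarrow> 'u2" and D2 :: "'u2 \<Rightarrow> 'u2"
    and J :: "'u1 \<Rightarrow> 'u2" and Q :: "'u2 \<Rightarrow> 'u2"
    and E :: "real set" and r :: real and N0 M0 M2 \<eta> :: "real \<Rightarrow> real"
  assumes "(UNIV :: 'u2 set) \<noteq> {0}"
    and "boundary_node DL1 G1 L1 K1" and "impedance_passive DL1 G1 L1 K1"
    and "clinear_on DA2 A2"
    and "\<exists>\<mu>. Re \<mu> > 0 \<and> (\<lambda>x. \<mu> *\<^sub>C x - A2 x) ` DA2 = UNIV"
    and "bounded_clinear B2" and "bounded_clinear C2" and "bounded_clinear D2"
    and "\<And>x u. x \<in> DA2 \<Longrightarrow>
          Re (cinner (A2 x + B2 u) x) \<le> Re (cinner (C2 x + D2 u) u)"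
    and "bounded_clinear J"
    and "selfadjoint Q" and "op_ge Q (\<lambda>_. 0)"
    and "E \<noteq> {}"
    and "E \<subseteq> {s. \<i> * complex_of_real s \<in>
          resolvent_set (ker_on DL1 (feedback_input G1 K1 J Q)) L1 \<inter> resolvent_set DA2 A2}"
    and "r > 0"
    and "\<And>s. s \<in> E \<Longrightarrow> N0 s \<ge> r" and "\<And>s. s \<in> E \<Longrightarrow> M0 s \<ge> r" and "\<And>s. s \<in> E \<Longrightarrow> M2 s \<ge> r"
    and "\<And>s. s \<in> E \<Longrightarrow>
          onorm (transfer_H DL1 (feedback_input G1 K1 J Q) L1 (\<i> * complex_of_real s)) \<le> N0 s"
    and "\<And>s. s \<in> E \<Longrightarrow>
          onorm (resolvent (ker_on DL1 (feedback_input G1 K1 J Q)) L1 (\<i> * complex_of_real s)) \<le> M0 s"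
    and "\<And>s. s \<in> E \<Longrightarrow> onorm (resolvent DA2 A2 (\<i> * complex_of_real s)) \<le> M2 s"
    and "\<And>s. s \<in> E \<Longrightarrow> \<eta> s > 0"
    and "\<And>s. s \<in> E \<Longrightarrow>
          op_ge (op_Re (\<lambda>u. C2 (resolvent DA2 A2 (\<i> * complex_of_real s) (B2 u)) + D2 u))
            (\<lambda>u. \<eta> s *\<^sub>R u)"
  shows "generates_contraction_semigroup
           (coupled_dom DL1 G1 K1 J DA2 C2 D2) (coupled_op L1 K1 J A2 B2) \<and>
         (\<lambda>s. \<i> * complex_of_real s) ` E \<subseteq>
           resolvent_set (coupled_dom DL1 G1 K1 J DA2 C2 D2) (coupled_op L1 K1 J A2 B2) \<and>
         (\<exists>C>0. \<forall>s\<in>E.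
           onorm (resolvent (coupled_dom DL1 G1 K1 J DA2 C2 D2) (coupled_op L1 K1 J A2 B2)
             (\<i> * complex_of_real s))
           \<le> C * (M0 s + (N0 s)\<^sup>2 * (M2 s)\<^sup>2 / \<eta> s))"
proof -
  interpret coupled_system DL1 DA2 L1 G1 K1 A2 B2 C2 D2 J Q
    by unfold_locales (use assms in \<open>simp_all add: Re_cinner\<close>)
  let ?\<mu> = "\<lambda>s. \<i> * complex_of_real s"
  let ?P = "\<lambda>s u. C2 (resolvent DA2 A2 (?\<mu> s) (B2 u)) + D2 u"
  \<comment> \<open>One constant dominating the norms of these operators; the summand
    \<open>1\<close> makes it positive.\<close>
  define b where "b = 1 + onorm B2 + onorm C2 + onorm D2 + onorm Ja + onorm Q"
  have bl: "bounded_linear B2" "bounded_linear C2" "bounded_linear D2" "bounded_linear Ja"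
    "bounded_linear Q"
    using B2 C2 D2 Ja Q_bc by (auto intro: bounded_clinear_imp_linear)
  note onorm_nonneg = bl[THEN onorm_pos_le]
  have b: "0 < b" using onorm_nonneg by (simp add: b_def)
  have bd: "norm (B2 u) \<le> b * norm u" "norm (C2 x) \<le> b * norm x" "norm (D2 u) \<le> b * norm u"
    "norm (Ja u) \<le> b * norm u" "norm (Q u) \<le> b * norm u" for u x
    using onorm_nonneg by (auto intro!: norm_le_onorm_bound bl simp: b_def)
  \<comment> \<open>Arranged so that \<open>M2 s \<ge> r\<close> gives
    \<open>b * b * M2 s + 2 * b \<le> p * M2 s\<close>, which bounds both \<open>P - Q\<close> and
    \<open>P\<close>.\<close>
  define p where "p = b * b + 2 * b / r"
  have p: "0 < p" using b assms(15) by (simp add: p_def add_pos_pos)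
  obtain C where C: "0 < C" and C_est:
    "\<And>N M0 M \<eta> a1 a2 z Y. \<lbrakk>r \<le> N; r \<le> M; 0 \<le> M0; 0 < \<eta>; \<eta> \<le> p * M; 0 \<le> a1; 0 \<le> z; 0 \<le> Y;
      \<eta> * z\<^sup>2 \<le> Y * a1 + b * M * Y * z; a1 \<le> M0 * Y + N * (b * (b * M * Y + p * M * z));
      a2 \<le> M * (Y + b * z)\<rbrakk> \<Longrightarrow> a1 + a2 \<le> C * (M0 + N\<^sup>2 * M\<^sup>2 / \<eta>) * Y"
    using coupled_estimate[OF assms(15) b p] by blast
  let ?c = "\<lambda>s. C * (M0 s + (N0 s)\<^sup>2 * (M2 s)\<^sup>2 / \<eta> s)"
  have point: "?\<mu> s \<in> resolvent_set Dom A \<and> onorm (resolvent Dom A (?\<mu> s)) \<le> ?c s" if s: "s \<in> E" for s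
  proof -
    have res: "?\<mu> s \<in> resolvent_set D0 L1" "?\<mu> s \<in> resolvent_set DA2 A2"
      using assms(14) s by auto
    have eta: "0 < \<eta> s" using assms(22) s by blast
    have M: "r \<le> N0 s" "r \<le> M2 s" "0 \<le> M0 s" using assms(15,16,17,18) s by force+
    note R2_bc = resolvent_bounded_clinear[OF res(2)]
    have P_bc: "bounded_clinear (?P s)"
      by (intro bounded_clinear_add bounded_clinear_compose[OF C2]
          bounded_clinear_compose[OF R2_bc] B2 D2)
    have P_ge: "\<eta> s * (norm u)\<^sup>2 \<le> inner (?P s u) u" for u
    proof -
      have "0 \<le> inner (op_Re (?P s) u - \<eta> s *\<^sub>R u) u"
        using assms(23)[OF s] by (simp add: op_ge_def Re_cinner)
      also have "\<dots> = inner (?P s u) u - \<eta> s * (norm u)\<^sup>2"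
        by (simp add: inner_diff_left inner_op_Re[OF P_bc] power2_norm_eq_inner)
      finally show ?thesis by simp
    qed
    \<comment> \<open>The placeholder stands for the premise that the point has real part zero, left
      to simplification at each use.\<close>
    note ctx = _ res eta P_ge
    have H_bc: "bounded_clinear (transfer_H DL1 G0 L1 (?\<mu> s))"
      by (rule transfer_H_facts(4)[OF ctx]) simp
    have R2_le: "norm (resolvent DA2 A2 (?\<mu> s) y) \<le> M2 s * norm y" for y
      using assms(21)[OF s] R2_bc by (intro norm_le_onorm_bound bounded_clinear_imp_linear)
    have R0_le: "norm (resolvent D0 L1 (?\<mu> s) y) \<le> M0 s * norm y" for y
      using assms(20)[OF s] resolvent_bounded_clinear[OF res(1)]
      by (intro norm_le_onorm_bound bounded_clinear_imp_linear)
    have H_le: "norm (transfer_H DL1 G0 L1 (?\<mu> s) u) \<le> N0 s * norm u" for u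
      using assms(19)[OF s] H_bc by (intro norm_le_onorm_bound bounded_clinear_imp_linear)
    have CR_le: "norm (C2 (resolvent DA2 A2 (?\<mu> s) y)) \<le> b * M2 s * norm y" for y
    proof -
      have "b * norm (resolvent DA2 A2 (?\<mu> s) y) \<le> b * (M2 s * norm y)"
        using b by (intro mult_left_mono R2_le) auto
      then show ?thesis
        using bd(2)[of "resolvent DA2 A2 (?\<mu> s) y"] by (simp add: mult.assoc)
    qed
    have pM: "(b * b * M2 s + 2 * b) * a \<le> p * M2 s * a" if "0 \<le> a" for a
    proof -
      have "2 * b / r * r \<le> 2 * b / r * M2 s" using b assms(15) M(2) by (intro mult_left_mono) auto
      then have "b * b * M2 s + 2 * b \<le> p * M2 s" using assms(15) by (simp add: p_def distrib_right)
      then show ?thesis using that by (rule mult_right_mono)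
    qed
    have CRB_le: "norm (C2 (resolvent DA2 A2 (?\<mu> s) (B2 u))) \<le> b * b * M2 s * norm u" for u
    proof -
      have "norm (C2 (resolvent DA2 A2 (?\<mu> s) (B2 u))) \<le> b * M2 s * norm (B2 u)" by (rule CR_le)
      also have "\<dots> \<le> b * M2 s * (b * norm u)"
        using b M(2) assms(15) by (intro mult_left_mono bd) auto
      finally show ?thesis by (simp add: mult_ac)
    qed
    have PQ_le: "norm (?P s u - Q u) \<le> p * M2 s * norm u" for u
    proof -
      have "norm (?P s u - Q u) \<le> b * b * M2 s * norm u + b * norm u + b * norm u"
        using norm_triangle_ineq4[of "?P s u" "Q u"] CRB_le[of u] bd(3,5)[of u]
          norm_triangle_ineq[of "C2 (resolvent DA2 A2 (?\<mu> s) (B2 u))" "D2 u"] by linarith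
      also have "\<dots> = (b * b * M2 s + 2 * b) * norm u" by (simp add: algebra_simps)
      also have "\<dots> \<le> p * M2 s * norm u" by (rule pM) simp
      finally show ?thesis .
    qed
    have eta_le: "\<eta> s \<le> p * M2 s"
    proof -
      \<comment> \<open>A nonzero vector turns coercivity into an upper bound on
        \<open>\<eta> s\<close> by the norm of the transfer function; on the zero space coercivity
        would say nothing about \<open>\<eta> s\<close>.\<close>
      obtain u :: 'u2 where u: "u \<noteq> 0" using assms(1) by auto
      have "0 \<le> b * norm u" using b by simp
      then have "norm (?P s u) \<le> (b * b * M2 s + 2 * b) * norm u"
        using CRB_le[of u] bd(3)[of u]
          norm_triangle_ineq[of "C2 (resolvent DA2 A2 (?\<mu> s) (B2 u))" "D2 u"]
        unfolding distrib_right by linarith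
      also have "\<dots> \<le> p * M2 s * norm u" by (rule pM) simp
      finally have "norm (?P s u) * norm u \<le> p * M2 s * norm u * norm u"
        by (rule mult_right_mono) simp
      then have "\<eta> s * (norm u)\<^sup>2 \<le> p * M2 s * (norm u)\<^sup>2"
        using P_ge[of u] norm_cauchy_schwarz[of "?P s u" u] unfolding power2_eq_square by linarith
      then show ?thesis using u by simp
    qed
    have est: "norm x \<le> ?c s * norm (?\<mu> s *\<^sub>C x - A x)" if x: "x \<in> Dom" for x
    proof -
      obtain x1 x2 where x12: "x = (x1, x2)" by force
      obtain y1 y2 where y: "?\<mu> s *\<^sub>C (x1, x2) - A (x1, x2) = (y1, y2)" by force
      let ?Y = "norm (y1, y2)" and ?z = "J (K1 x1)" and ?Cy = "C2 (resolvent DA2 A2 (?\<mu> s) y2)"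
      have Y: "norm y1 \<le> ?Y" "norm y2 \<le> ?Y" using norm_fst_le[of y1 y2] norm_snd_le[of y2 y1] by auto
      note facts = coupled_solution_facts[OF ctx x[unfolded x12] y, simplified]
      have Cy: "norm ?Cy \<le> b * M2 s * ?Y"
        by (rule order_trans[OF CR_le], rule mult_left_mono[OF Y(2)]) (use b M(2) assms(15) in simp)
      have "norm x1 + norm x2 \<le> ?c s * ?Y"
      proof (rule C_est[OF M eta eta_le, where z = "norm ?z"])
        have "norm y1 * norm x1 \<le> ?Y * norm x1" using Y by (intro mult_right_mono) auto
        moreover have "norm ?Cy * norm ?z \<le> b * M2 s * ?Y * norm ?z"
          using Cy by (intro mult_right_mono) auto
        ultimately show "\<eta> s * (norm ?z)\<^sup>2 \<le> ?Y * norm x1 + b * M2 s * ?Y * norm ?z"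
          using facts(1) by linarith
        let ?w = "?Cy - (?P s ?z - Q ?z)"
        have "norm ?w \<le> b * M2 s * ?Y + p * M2 s * norm ?z"
          using norm_triangle_ineq4[of ?Cy "?P s ?z - Q ?z"] Cy PQ_le[of ?z] by linarith
        then have "b * norm ?w \<le> b * (b * M2 s * ?Y + p * M2 s * norm ?z)"
          using b by (intro mult_left_mono) auto
        then have "norm (Ja ?w) \<le> b * (b * M2 s * ?Y + p * M2 s * norm ?z)"
          using bd(4)[of ?w] by linarith
        then have "N0 s * norm (Ja ?w) \<le> N0 s * (b * (b * M2 s * ?Y + p * M2 s * norm ?z))"
          using M(1) assms(15) by (intro mult_left_mono) auto
        moreover have "M0 s * norm y1 \<le> M0 s * ?Y" using M Y by (intro mult_left_mono) auto
        moreover have "norm x1 \<le> norm (resolvent D0 L1 (?\<mu> s) y1)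
            + norm (transfer_H DL1 G0 L1 (?\<mu> s) (Ja ?w))"
          by (subst facts(2)) (rule norm_triangle_ineq)
        ultimately show "norm x1 \<le> M0 s * ?Y + N0 s * (b * (b * M2 s * ?Y + p * M2 s * norm ?z))"
          using R0_le[of y1] H_le[of "Ja ?w"] by linarith
        have "norm (y2 - B2 ?z) \<le> ?Y + b * norm ?z"
          using norm_triangle_ineq4[of y2 "B2 ?z"] Y bd(1)[of ?z] by linarith
        then have "M2 s * norm (y2 - B2 ?z) \<le> M2 s * (?Y + b * norm ?z)"
          using M assms(15) by (intro mult_left_mono) auto
        then show "norm x2 \<le> M2 s * (?Y + b * norm ?z)"
          using R2_le[of "y2 - B2 ?z"] by (subst facts(3)) linarith
      qed simp_all
      then show ?thesis
        using norm_Pair_le[of x1 x2] unfolding x12 y by linarith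
    qed
    have surj: "\<exists>x\<in>Dom. ?\<mu> s *\<^sub>C x - A x = y" for y
      by (rule coupled_surj[OF ctx]) simp
    note R = resolvent_setI[OF clinear_on_A est surj]
    have "0 \<le> ?c s" using C M eta by simp
    then have "onorm (resolvent Dom A (?\<mu> s)) \<le> ?c s" using R(2) by (rule onorm_bound)
    with R(1) show ?thesis by blast
  qed
  obtain s0 where s0: "s0 \<in> E" using assms(13) by blast
  have "m_dissipative Dom A"
    using clinear_on_A dissipative_A by (rule m_dissipativeI[of _ _ "?\<mu> s0"]) (use point[OF s0] in auto)
  then have "generates_contraction_semigroup Dom A"
    by (rule m_dissipative.generates_contraction_semigroup)
  then show ?thesis using point C by blast
qed

end
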